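(* Let $\pi^X_k$ be the law of the $k$-th iterate returned by the proximal sampler on $\mathbb{R}^d$ with step size $h>0$, initial distribution $\pi^X_0$, and target distribution $\pi^X$. Given $1<p\le q$, we have $\mathcal{R}_q(\pi^X_N\|\pi^X)\le\mathcal{R}_p(\pi^X_0\|\pi^X)$ after $$N\lesssim h^{-1}C_{\mathsf{LSI}}(\pi^X)\log_2\frac{q-1}{p-1}\quad\text{iterations}.$$ Moreover, given $\varepsilon>0$ and $q\ge q_0>1$, we have $\mathcal{R}_q(\pi^X_N\|\pi^X)\le\varepsilon$ after $$N\lesssim h^{-1}C_{\mathsf{LSI}}(\pi^X)\log\frac{q\,\mathcal{R}_{2\wedge q_0}(\pi^X_0\|\pi^X)}{(2\wedge q_0-1)\,\varepsilon}\quad\text{iterations}.$$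
   Context: Proximal sampler: let $\gamma_h$ be the density of $\mathcal{N}(0,hI_d)$ and $\pi(x,y)\propto\pi^X(x)\gamma_h(y-x)$ on $\mathbb{R}^d\times\mathbb{R}^d$. Starting from $x_0\sim\pi^X_0$, each iteration draws (i) $y_{k+1}\sim\pi^{Y|X=x_k}=\mathcal{N}(x_k,hI_d)$ and (ii) $x_{k+1}\sim\pi^{X|Y=y_{k+1}}\propto\pi^X(\cdot)\gamma_h(\cdot-y_{k+1})$; $\pi^X_k$ is the law of $x_k$. For $\mu\ll\nu$ and $q\in(1,\infty)$, $\mathcal{R}_q(\mu\|\nu)=\frac{q}{q-1}\log\|\frac{d\mu}{d\nu}\|_{L^q(\nu)}$. $C_{\mathsf{LSI}}(\pi)$ is the smallest $C$ such that $\int f^2\log f^2\,d\pi-\int f^2\,d\pi\log\int f^2\,d\pi\le2C\int|\nabla f|^2\,d\pi$ for all locally Lipschitz $f\in L^2(\pi)$. $a\lesssim b$ means $a\le cb$ for a universal constant $c>0$; $a\wedge b=\min(a,b)$.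
   Formalization: In both bounds h^{-1}C_LSI is replaced by max(1, h^{-1}C_LSI), and in the second R_{2∧q0} is replaced by max(R_{2∧q0}, ε); as written the bounds fail for h much larger than C_LSI and for R_{2∧q0} much smaller than ε. *)

theory Defs
  imports "HOL-Probability.Probability"
begin

text \<open>The dimension is a natural number rather than a type, so that a universal constant can be
  quantified outside the dimension: points of the \<open>d\<close>-dimensional space are the functions in
  \<open>{..<d} \<rightarrow>\<^sub>E UNIV\<close>.\<close>

definition Rd :: "nat \<Rightarrow> (nat \<Rightarrow> real) measure" where
  "Rd d = (\<Pi>\<^sub>M i\<in>{..<d}. lborel)"

definition euclid_dist :: "nat \<Rightarrow> (nat \<Rightarrow> real) \<Rightarrow> (nat \<Rightarrow> real) \<Rightarrow> real" where
  "euclid_dist d x y = L2_set (\<lambda>i. x i - y i) {..<d}"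

definition locally_Lipschitz :: "nat \<Rightarrow> ((nat \<Rightarrow> real) \<Rightarrow> real) \<Rightarrow> bool" where
  "locally_Lipschitz d f \<longleftrightarrow>
     (\<forall>x\<in>space (Rd d). \<exists>r>0. \<exists>L. \<forall>y\<in>space (Rd d). \<forall>z\<in>space (Rd d).
        euclid_dist d x y < r \<longrightarrow> euclid_dist d x z < r \<longrightarrow>
        \<bar>f y - f z\<bar> \<le> L * euclid_dist d y z)"

text \<open>A locally Lipschitz function has partial derivatives Lebesgue-almost everywhere; \<open>deriv\<close>
  takes one fixed unspecified value elsewhere, which no integral against an absolutely continuous
  measure sees.\<close>

definition grad_sq :: "nat \<Rightarrow> ((nat \<Rightarrow> real) \<Rightarrow> real) \<Rightarrow> (nat \<Rightarrow> real) \<Rightarrow> real" where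
  "grad_sq d f x = (\<Sum>i<d. (deriv (\<lambda>t. f (x(i := t))) (x i))\<^sup>2)"

text \<open>If the right-hand side is infinite there is nothing to require. If it is finite, the
  inequality includes finiteness of the first integral on the left; as \<open>u * ln u\<close> is bounded below,
  that is integrability.\<close>

definition LSI :: "nat \<Rightarrow> (nat \<Rightarrow> real) measure \<Rightarrow> real \<Rightarrow> bool" where
  "LSI d \<pi> C \<longleftrightarrow> 0 \<le> C \<and>
     (\<forall>f. locally_Lipschitz d f \<longrightarrow> integrable \<pi> (\<lambda>x. (f x)\<^sup>2) \<longrightarrow> integrable \<pi> (grad_sq d f) \<longrightarrow>
        integrable \<pi> (\<lambda>x. (f x)\<^sup>2 * ln ((f x)\<^sup>2)) \<and>
        (\<integral>x. (f x)\<^sup>2 * ln ((f x)\<^sup>2) \<partial>\<pi>) - (\<integral>x. (f x)\<^sup>2 \<partial>\<pi>) * ln (\<integral>x. (f x)\<^sup>2 \<partial>\<pi>)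
          \<le> 2 * C * (\<integral>x. grad_sq d f x \<partial>\<pi>))"

definition C_LSI :: "nat \<Rightarrow> (nat \<Rightarrow> real) measure \<Rightarrow> real" where
  "C_LSI d \<pi> = Inf {C. LSI d \<pi> C}"

text \<open>The value is infinite if \<open>\<mu>\<close> is not absolutely continuous with respect to \<open>\<nu>\<close>, or if its
  density is not in \<open>L\<^sup>q(\<nu>)\<close>.\<close>

definition Renyi :: "real \<Rightarrow> 'a measure \<Rightarrow> 'a measure \<Rightarrow> ereal" where
  "Renyi q \<mu> \<nu> =
     (if absolutely_continuous \<nu> \<mu> \<and> integrable \<nu> (\<lambda>x. enn2real (RN_deriv \<nu> \<mu> x) powr q)
      then ereal (q / (q - 1) * ln ((\<integral>x. enn2real (RN_deriv \<nu> \<mu> x) powr q \<partial>\<nu>) powr (1 / q)))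
      else \<infinity>)"

definition gauss :: "nat \<Rightarrow> real \<Rightarrow> (nat \<Rightarrow> real) \<Rightarrow> real" where
  "gauss d h z = (\<Prod>i<d. normal_density 0 (sqrt h) (z i))"

definition Y_given_X :: "nat \<Rightarrow> real \<Rightarrow> (nat \<Rightarrow> real) \<Rightarrow> (nat \<Rightarrow> real) measure" where
  "Y_given_X d h x = density (Rd d) (\<lambda>y. ennreal (gauss d h (\<lambda>i. y i - x i)))"

definition X_given_Y ::
  "nat \<Rightarrow> real \<Rightarrow> (nat \<Rightarrow> real) measure \<Rightarrow> (nat \<Rightarrow> real) \<Rightarrow> (nat \<Rightarrow> real) measure" where
  "X_given_Y d h \<pi> y =
     density \<pi> (\<lambda>x. ennreal (gauss d h (\<lambda>i. x i - y i))
                    / (\<integral>\<^sup>+z. ennreal (gauss d h (\<lambda>i. z i - y i)) \<partial>\<pi>))"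

primrec proximal_law ::
  "nat \<Rightarrow> real \<Rightarrow> (nat \<Rightarrow> real) measure \<Rightarrow> (nat \<Rightarrow> real) measure \<Rightarrow> nat \<Rightarrow> (nat \<Rightarrow> real) measure"
where
  "proximal_law d h \<pi> \<pi>0 0 = \<pi>0"
| "proximal_law d h \<pi> \<pi>0 (Suc k) =
     (proximal_law d h \<pi> \<pi>0 k \<bind> Y_given_X d h) \<bind> X_given_Y d h \<pi>"

end

theory Submission
  imports Defs
begin

text \<open>If \<open>f\<close> is the density of the current iterate with respect to \<open>\<pi>\<close>, one step replaces \<open>f\<close> by
  \<open>P g\<close>, where \<open>g(y) = E[f(X) | Y = y]\<close> and \<open>P\<close> is convolution with \<open>N(0, h I)\<close>. By Jensen,
  \<open>\<integral> P(g\<^sup>p) d\<pi> \<le> \<integral> f\<^sup>p d\<pi>\<close>, so it suffices to bound the \<open>L\<^sup>q(\<pi>)\<close> norm of \<open>P g\<close> by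
  \<open>(\<integral> P(g\<^sup>p) d\<pi>)\<close> to the power \<open>1/p\<close> for \<open>q - 1 = (p - 1)(1 + h/C)\<close>. The two sides are joined through
  \<open>\<psi>\<^sub>r = (1/r) ln P(g\<^sup>r)\<close>, \<open>1 \<le> r \<le> p\<close>: the reverse log-Sobolev inequality of the Gaussian kernel says
  \<open>\<partial>\<^sub>r \<psi>\<^sub>r \<ge> (h/2) |\<nabla> \<psi>\<^sub>r|\<^sup>2\<close>, and together with the log-Sobolev inequality of \<open>\<pi>\<close> this makes
  \<open>(1/a(r)) ln \<integral> exp(a(r) \<psi>\<^sub>r) d\<pi>\<close> nondecreasing for \<open>a(r) = p + (p - r) h/C\<close>.
  Only the log-Sobolev inequality of \<open>\<pi>\<close> itself is used, not that of its heat flow.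

  Iterating gives hypercontractivity. The same one-step bound at \<open>p = 2\<close> contracts the Renyi divergence of order 2
  by a fixed factor, so the second bound follows by raising the order to 2, contracting, and raising it to \<open>q\<close>.\<close>

section \<open>The Gaussian kernel\<close>

text \<open>The slope of \<open>a\<close> is forced. Up to a common normalisation, the derivative of
  \<open>(1/a(r)) ln \<integral> exp(a(r) \<psi>\<^sub>r) d\<pi>\<close> is
  \<open>a' / a\<^sup>2\<close> times the entropy of \<open>exp(a \<psi>\<^sub>r)\<close>, plus an
  integral of \<open>\<partial>\<^sub>r \<psi>\<^sub>r\<close> that is at least \<open>h/2\<close>
  times the energy \<open>\<integral> exp(a \<psi>\<^sub>r) |\<nabla> \<psi>\<^sub>r|\<^sup>2
  d\<pi>\<close>. The log-Sobolev inequality for \<open>exp(a \<psi>\<^sub>r / 2)\<close> bounds the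
  entropy by \<open>C a\<^sup>2 / 2\<close> times the same energy. The powers of \<open>a\<close>
  cancel, so a constant slope suffices, and \<open>- h/C\<close> is the steepest one allowed; with
  \<open>a(p) = p\<close> this fixes \<open>a\<close>, and the order reached is \<open>a(1)\<close>.
  The obstacle is regularity: \<open>g\<close> is only measurable and may vanish or be unbounded,
  while the argument takes logarithms, differentiates under integrals and needs a locally Lipschitz
  test function. Truncating \<open>g\<close> between positive constants bounds its logarithm,
  Gaussian averages of bounded functions are locally Lipschitz, and Fatou's lemma removes the
  truncation.\<close>

lemma has_real_derivative_integral:
  fixes F F' :: "real \<Rightarrow> 'a \<Rightarrow> real"
  assumes e: "e > 0"
    and int: "\<And>s. \<bar>s - a\<bar> < e \<Longrightarrow> integrable M (F s)"
    and der: "\<And>s x. \<bar>s - a\<bar> < e \<Longrightarrow> x \<in> space M \<Longrightarrow> ((\<lambda>s. F s x) has_real_derivative F' s x) (at s)"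
    and bound: "\<And>s x. \<bar>s - a\<bar> < e \<Longrightarrow> x \<in> space M \<Longrightarrow> \<bar>F' s x\<bar> \<le> w x"
    and w: "integrable M w"
    and meas: "F' a \<in> borel_measurable M"
  shows "((\<lambda>s. \<integral>x. F s x \<partial>M) has_real_derivative (\<integral>x. F' a x \<partial>M)) (at a)"
  unfolding has_field_derivative_iff tendsto_at_iff_sequentially
proof (intro allI impI)
  fix X :: "nat \<Rightarrow> real"
  assume X: "\<forall>i. X i \<in> UNIV - {a}" "X \<longlonglongrightarrow> a"
  have ev: "\<forall>\<^sub>F n in sequentially. \<bar>X n - a\<bar> < e"
    using tendstoD[OF X(2) e] by (simp add: dist_real_def)
  \<comment> \<open>Dominated convergence wants its hypotheses at every index, while integrability
    and the derivative bound hold only near \<open>a\<close>; hence the shift by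
    \<open>n0\<close>.\<close>
  then obtain n0 where n0: "\<And>n. n \<ge> n0 \<Longrightarrow> \<bar>X n - a\<bar> < e"
    by (auto simp: eventually_sequentially)
  define q where "q n x = (F (X (n + n0)) x - F a x) / (X (n + n0) - a)" for n x
  have near: "\<bar>X (n + n0) - a\<bar> < e" for n using n0 by simp
  have ia: "integrable M (F a)" using int[of a] e by simp
  have qint: "integrable M (q n)" for n
    unfolding q_def using int[OF near] ia by auto
  have lim: "(\<lambda>n. q n x) \<longlonglongrightarrow> F' a x" if "x \<in> space M" for x
  proof -
    have "((\<lambda>s. F s x) has_real_derivative F' a x) (at a)" using der[of a x] e that by simp
    then have "(\<lambda>n. (F (X n) x - F a x) / (X n - a)) \<longlonglongrightarrow> F' a x"
      using X unfolding has_field_derivative_iff tendsto_at_iff_sequentially comp_def by blast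
    then show ?thesis unfolding q_def by (rule LIMSEQ_ignore_initial_segment)
  qed
  \<comment> \<open>The mean value inequality turns the bound on \<open>F'\<close> into the same
    bound on the difference quotients.\<close>
  have qb: "norm (q n x) \<le> w x" if x: "x \<in> space M" for n x
  proof -
    let ?S = "{a - \<bar>X (n+n0) - a\<bar> .. a + \<bar>X (n+n0) - a\<bar>}"
    have "norm (F (X (n+n0)) x - F a x) \<le> w x * norm (X (n+n0) - a)"
    proof (rule field_differentiable_bound[where S="?S" and f' = "\<lambda>s. F' s x"])
      fix s assume "s \<in> ?S"
      then have "\<bar>s - a\<bar> < e" using near[of n] by auto
      then show "((\<lambda>s. F s x) has_real_derivative F' s x) (at s within ?S)"
        "norm (F' s x) \<le> w x"
        using der bound x by (auto intro: has_field_derivative_at_within)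
    qed auto
    moreover have "X (n+n0) \<noteq> a" using X(1) by auto
    ultimately show ?thesis unfolding q_def by (simp add: divide_le_eq abs_divide)
  qed
  have "(\<lambda>n. \<integral>x. q n x \<partial>M) \<longlonglongrightarrow> (\<integral>x. F' a x \<partial>M)"
    by (rule integral_dominated_convergence[where w=w])
      (use meas qint w lim qb in \<open>auto intro!: AE_I2\<close>)
  moreover have "(\<integral>x. q n x \<partial>M) = ((\<integral>x. F (X (n+n0)) x \<partial>M) - (\<integral>x. F a x \<partial>M)) / (X (n+n0) - a)" for n
    unfolding q_def using int[OF near] ia by simp
  ultimately have "(\<lambda>n. ((\<integral>x. F (X (n+n0)) x \<partial>M) - (\<integral>x. F a x \<partial>M)) / (X (n+n0) - a)) \<longlonglongrightarrow> (\<integral>x. F' a x \<partial>M)"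
    by simp
  then show "((\<lambda>s. ((\<integral>x. F s x \<partial>M) - (\<integral>x. F a x \<partial>M)) / (s - a)) \<circ> X) \<longlonglongrightarrow> (\<integral>x. F' a x \<partial>M)"
    unfolding comp_def by (rule LIMSEQ_offset[where k=n0])
qed

lemma sigma_finite_Rd: "sigma_finite_measure (Rd d)"
proof -
  interpret product_sigma_finite "\<lambda>i::nat. lborel :: real measure"
    by (simp add: product_sigma_finite_def lborel.sigma_finite_measure_axioms)
  show ?thesis unfolding Rd_def by (rule sigma_finite) simp
qed

lemma measurable_Rd_component [measurable]:
  "i < d \<Longrightarrow> (\<lambda>x. x i) \<in> borel_measurable (Rd d)"
  unfolding Rd_def using measurable_component_singleton[of i "{..<d}" "\<lambda>_. lborel :: real measure"] by simp

locale gaussian_kernel =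
  fixes d :: nat and h :: real
  assumes h_pos: "h > 0"
begin

abbreviation kern :: "(nat \<Rightarrow> real) \<Rightarrow> (nat \<Rightarrow> real) \<Rightarrow> real" where
  "kern x z \<equiv> gauss d h (\<lambda>i. z i - x i)"

abbreviation \<gamma> :: "(nat \<Rightarrow> real) \<Rightarrow> (nat \<Rightarrow> real) measure" where
  "\<gamma> \<equiv> Y_given_X d h"

sublocale Rd: sigma_finite_measure "Rd d"
  by (rule sigma_finite_Rd)

lemma kern_eq: "kern x z = (1 / sqrt (2 * pi * h)) ^ d * exp (- (\<Sum>i<d. (z i - x i)\<^sup>2) / (2 * h))"
proof -
  have "kern x z = (\<Prod>i<d. 1 / sqrt (2 * pi * h) * exp (- ((z i - x i)\<^sup>2 / (2 * h))))"
    unfolding gauss_def normal_density_def using h_pos by simp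
  also have "\<dots> = (1 / sqrt (2 * pi * h)) ^ d * exp (\<Sum>i<d. - ((z i - x i)\<^sup>2 / (2 * h)))"
    by (simp add: prod.distrib exp_sum power_divide prod_dividef)
  finally show ?thesis by (simp add: sum_negf sum_divide_distrib)
qed

lemma kern_pos: "kern x z > 0"
  unfolding kern_eq using h_pos by simp

lemma kern_commute: "kern x z = kern z x"
  unfolding kern_eq by (simp add: power2_commute)

lemma kern_le: "kern x z \<le> (1 / sqrt (2 * pi * h)) ^ d"
proof -
  have "exp (- (\<Sum>i<d. (z i - x i)\<^sup>2) / (2 * h)) \<le> 1"
    using h_pos by (simp add: sum_nonneg)
  then show ?thesis unfolding kern_eq
    using h_pos by (intro mult_left_le) auto
qed

text \<open>Cameron-Martin formula, by expanding the square. It is the source of the exponential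
  moments, the derivatives and the Lipschitz bounds of the kernel below.\<close>

lemma kern_shift:
  "kern (\<lambda>i. x i + v i) z =
     kern x z * exp ((\<Sum>i<d. v i * (z i - x i)) / h - (\<Sum>i<d. (v i)\<^sup>2) / (2 * h))"
proof -
  have "- (\<Sum>i<d. (z i - (x i + v i))\<^sup>2) =
        - (\<Sum>i<d. (z i - x i)\<^sup>2) + 2 * (\<Sum>i<d. v i * (z i - x i)) - (\<Sum>i<d. (v i)\<^sup>2)"
    unfolding sum_negf[symmetric] sum_distrib_left sum.distrib[symmetric] sum_subtractf[symmetric]
    by (intro sum.cong) (auto simp: power2_eq_square algebra_simps)
  then show ?thesis
    unfolding kern_eq mult.assoc exp_add[symmetric]
    by (simp only:) (simp add: add_divide_distrib diff_divide_distrib)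
qed

lemma measurable_kern_pair [measurable]:
  "(\<lambda>p. kern (fst p) (snd p)) \<in> borel_measurable (Rd d \<Otimes>\<^sub>M Rd d)"
  unfolding kern_eq by measurable

lemma measurable_kern [measurable]:
  "kern x \<in> borel_measurable (Rd d)" "(\<lambda>x. kern x z) \<in> borel_measurable (Rd d)"
  unfolding kern_eq by measurable

lemma nn_integral_kern: "(\<integral>\<^sup>+z. ennreal (kern x z) \<partial>Rd d) = 1"
proof -
  interpret product_sigma_finite "\<lambda>i::nat. lborel :: real measure"
    by (simp add: product_sigma_finite_def lborel.sigma_finite_measure_axioms)
  have 1: "(\<integral>\<^sup>+t. ennreal (normal_density 0 (sqrt h) (t - c)) \<partial>lborel) = 1" for c
  proof -
    have "(\<integral>\<^sup>+t. ennreal (normal_density c (sqrt h) t) \<partial>lborel) = ennreal 1"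
      using h_pos by (subst nn_integral_eq_integral) (auto intro: integrable_normal_density)
    moreover have "normal_density c (sqrt h) t = normal_density 0 (sqrt h) (t - c)" for t
      by (simp add: normal_density_def)
    ultimately show ?thesis by simp
  qed
  have "(\<integral>\<^sup>+z. ennreal (kern x z) \<partial>Rd d) =
        (\<integral>\<^sup>+z. (\<Prod>i<d. ennreal (normal_density 0 (sqrt h) (z i - x i))) \<partial>Rd d)"
    unfolding gauss_def by (intro nn_integral_cong) (simp add: prod_ennreal)
  also have "\<dots> = 1"
    unfolding Rd_def by (subst product_nn_integral_prod) (auto simp: 1)
  finally show ?thesis .
qed

lemma sets_\<gamma> [simp, measurable_cong]: "sets (\<gamma> x) = sets (Rd d)"
  and space_\<gamma> [simp]: "space (\<gamma> x) = space (Rd d)"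
  unfolding Y_given_X_def by auto

lemma prob_space_\<gamma>: "prob_space (\<gamma> x)"
  by (rule prob_spaceI) (simp add: Y_given_X_def emeasure_density nn_integral_kern cong: nn_integral_cong)

lemma integral_\<gamma>:
  fixes f :: "_ \<Rightarrow> real"
  assumes [measurable]: "f \<in> borel_measurable (Rd d)"
  shows "(\<integral>z. f z \<partial>\<gamma> x) = (\<integral>z. kern x z * f z \<partial>Rd d)"
  unfolding Y_given_X_def using less_imp_le[OF kern_pos]
  by (subst integral_density) auto

lemma nn_integral_\<gamma>:
  assumes [measurable]: "f \<in> borel_measurable (Rd d)"
  shows "(\<integral>\<^sup>+z. f z \<partial>\<gamma> x) = (\<integral>\<^sup>+z. ennreal (kern x z) * f z \<partial>Rd d)"
  unfolding Y_given_X_def by (subst nn_integral_density) auto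

lemma integrable_bounded_\<gamma>:
  fixes f :: "_ \<Rightarrow> real"
  assumes "f \<in> borel_measurable (Rd d)" "\<And>z. z \<in> space (Rd d) \<Longrightarrow> \<bar>f z\<bar> \<le> B"
  shows "integrable (\<gamma> x) f"
proof -
  interpret prob_space "\<gamma> x" by (rule prob_space_\<gamma>)
  show ?thesis using assms by (intro integrable_const_bound[where B=B]) auto
qed

lemma measurable_integral_\<gamma> [measurable]:
  fixes f :: "_ \<Rightarrow> real"
  assumes [measurable]: "f \<in> borel_measurable (Rd d)"
  shows "(\<lambda>x. \<integral>z. f z \<partial>\<gamma> x) \<in> borel_measurable (Rd d)"
  unfolding integral_\<gamma>[OF assms]
proof (rule Rd.borel_measurable_lebesgue_integral)
  have "(\<lambda>p. kern (fst p) (snd p) * f (snd p)) \<in> borel_measurable (Rd d \<Otimes>\<^sub>M Rd d)" by measurable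
  then show "(\<lambda>(x, z). kern x z * f z) \<in> borel_measurable (Rd d \<Otimes>\<^sub>M Rd d)"
    by (simp add: case_prod_beta')
qed

text \<open>By \<open>kern_shift\<close> the integrand times the kernel is a constant multiple of
  the kernel centred at \<open>x + v\<close>, which has mass one.\<close>

lemma has_bochner_integral_exp_\<gamma>:
  "has_bochner_integral (\<gamma> x) (\<lambda>z. exp ((\<Sum>i<d. v i * (z i - x i)) / h)) (exp ((\<Sum>i<d. (v i)\<^sup>2) / (2 * h)))"
proof (rule has_bochner_integral_nn_integral)
  let ?c = "exp ((\<Sum>i<d. (v i)\<^sup>2) / (2 * h))"
  have "(\<integral>\<^sup>+z. ennreal (exp ((\<Sum>i<d. v i * (z i - x i)) / h)) \<partial>\<gamma> x) =
        (\<integral>\<^sup>+z. ennreal (kern x z) * ennreal (exp ((\<Sum>i<d. v i * (z i - x i)) / h)) \<partial>Rd d)"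
    by (rule nn_integral_\<gamma>) measurable
  also have "\<dots> = (\<integral>\<^sup>+z. ennreal ?c * ennreal (kern (\<lambda>i. x i + v i) z) \<partial>Rd d)"
    unfolding kern_shift using less_imp_le[OF kern_pos]
    by (intro nn_integral_cong) (simp add: ennreal_mult[symmetric] exp_diff)
  also have "\<dots> = ennreal ?c"
    by (subst nn_integral_cmult) (auto simp: nn_integral_kern)
  finally show "(\<integral>\<^sup>+z. ennreal (exp ((\<Sum>i<d. v i * (z i - x i)) / h)) \<partial>\<gamma> x) = ennreal ?c" .
qed auto

lemma integrable_exp_component_\<gamma>:
  assumes "i < d"
  shows "integrable (\<gamma> x) (\<lambda>z. exp (c * (z i - x i) / h))"
proof -
  have "(\<Sum>j<d. (if j = i then c else 0) * (z j - x j)) = c * (z i - x i)" for z :: "nat \<Rightarrow> real"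
    using assms by (simp add: if_distrib[of "\<lambda>t. t * _"] cong: if_cong)
  then show ?thesis
    using has_bochner_integral_exp_\<gamma>[of x "\<lambda>j. if j = i then c else 0"]
    by (simp add: has_bochner_integral_iff)
qed

lemma integrable_component_\<gamma>:
  fixes f :: "_ \<Rightarrow> real"
  assumes i: "i < d" and [measurable]: "f \<in> borel_measurable (Rd d)"
    and f: "\<And>z. z \<in> space (Rd d) \<Longrightarrow> \<bar>f z\<bar> \<le> B"
  shows "integrable (\<gamma> x) (\<lambda>z. f z * ((z i - x i) / h))"
proof (rule Bochner_Integration.integrable_bound)
  show "integrable (\<gamma> x) (\<lambda>z. B * (exp (1 * (z i - x i) / h) + exp ((- 1) * (z i - x i) / h)))"
    using integrable_exp_component_\<gamma>[OF i] by (intro integrable_mult_right Bochner_Integration.integrable_add)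
  show "(\<lambda>z. f z * ((z i - x i) / h)) \<in> borel_measurable (\<gamma> x)" using i by measurable
  have "\<bar>t\<bar> \<le> exp t + exp (- t)" for t :: real
    using exp_ge_add_one_self[of t] exp_ge_add_one_self[of "- t"] exp_gt_zero[of t] exp_gt_zero[of "- t"] by linarith
  then have *: "\<bar>(z i - x i) / h\<bar> \<le> exp (1 * (z i - x i) / h) + exp ((- 1) * (z i - x i) / h)" for z
    by (metis mult_1 mult_minus1 minus_divide_left)
  have "\<bar>f z * ((z i - x i) / h)\<bar> \<le> \<bar>B * (exp (1 * (z i - x i) / h) + exp ((- 1) * (z i - x i) / h))\<bar>"
    if "z \<in> space (Rd d)" for z
  proof -
    have "\<bar>f z\<bar> * \<bar>(z i - x i) / h\<bar> \<le> B * (exp (1 * (z i - x i) / h) + exp ((- 1) * (z i - x i) / h))"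
      using f[OF that] by (intro mult_mono *) auto
    then show ?thesis unfolding abs_mult[of "f z"] by linarith
  qed
  then show "AE z in \<gamma> x. norm (f z * ((z i - x i) / h)) \<le> norm (B * (exp (1 * (z i - x i) / h) + exp ((- 1) * (z i - x i) / h)))"
    by (intro AE_I2) simp
qed

text \<open>Since \<open>f\<close> is only measurable, the derivative has to fall on the kernel:
  moving the centre by \<open>s\<close> is rewritten as a factor
  \<open>exp (s * u z - s\<^sup>2 / (2 * h))\<close> under a fixed measure, whose derivative at
  \<open>s = 0\<close> is \<open>u z\<close>.\<close>

lemma heat_deriv:
  fixes f :: "_ \<Rightarrow> real"
  assumes i: "i < d" and [measurable]: "f \<in> borel_measurable (Rd d)"
    and f: "\<And>z. z \<in> space (Rd d) \<Longrightarrow> \<bar>f z\<bar> \<le> B"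
  shows "((\<lambda>t. \<integral>z. f z \<partial>\<gamma> (x(i := t))) has_real_derivative (\<integral>z. f z * ((z i - x i) / h) \<partial>\<gamma> x)) (at (x i))"
proof -
  define u where "u z = (z i - x i) / h" for z :: "nat \<Rightarrow> real"
  define F where "F s z = f z * exp (s * u z - s\<^sup>2 / (2 * h))" for s z
  define F' where "F' s z = f z * exp (s * u z - s\<^sup>2 / (2 * h)) * (u z - s / h)" for s z
  have [measurable]: "u \<in> borel_measurable (Rd d)" unfolding u_def using i by measurable
  have int_exp: "integrable (\<gamma> x) (\<lambda>z. exp (c * u z))" for c
    using integrable_exp_component_\<gamma>[OF i, of x c] by (simp add: u_def)
  have shift: "(\<integral>z. f z \<partial>\<gamma> (x(i := x i + s))) = (\<integral>z. F s z \<partial>\<gamma> x)" for s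
  proof -
    define v where "v j = (if j = i then s else 0)" for j
    have "(\<Sum>j<d. v j * (z j - x j)) = s * (z i - x i)" for z :: "nat \<Rightarrow> real"
      unfolding v_def using i by (simp add: if_distrib[of "\<lambda>t. t * _"] cong: if_cong)
    moreover have "(\<Sum>j<d. (v j)\<^sup>2) = s\<^sup>2"
      unfolding v_def using i by (simp add: if_distrib[of "\<lambda>t. t\<^sup>2"] cong: if_cong)
    moreover have "x(i := x i + s) = (\<lambda>j. x j + v j)" by (auto simp: v_def)
    ultimately have k: "kern (x(i := x i + s)) z = kern x z * exp (s * u z - s\<^sup>2 / (2 * h))" for z
      using kern_shift[where x=x and v=v and z=z] by (simp add: u_def)
    have [measurable]: "F s \<in> borel_measurable (Rd d)" unfolding F_def by measurable
    show ?thesis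
      unfolding integral_\<gamma>[OF assms(2)] integral_\<gamma>[OF \<open>F s \<in> _\<close>] k by (simp add: F_def mult_ac)
  qed
  have B: "B \<ge> 0" if "z \<in> space (Rd d)" for z using f[OF that] by linarith
  have e1: "exp (s * u z - s\<^sup>2 / (2 * h)) \<le> exp \<bar>u z\<bar>" if "\<bar>s\<bar> < 1" for s z
  proof -
    have "s * u z \<le> \<bar>s\<bar> * \<bar>u z\<bar>" by (metis abs_ge_self abs_mult)
    also have "\<dots> \<le> 1 * \<bar>u z\<bar>" using that by (intro mult_right_mono) auto
    finally have "s * u z \<le> \<bar>u z\<bar>" by simp
    moreover have "0 \<le> s\<^sup>2 / (2 * h)" using h_pos by simp
    ultimately have "s * u z - s\<^sup>2 / (2 * h) \<le> \<bar>u z\<bar>" by linarith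
    then show ?thesis by simp
  qed
  have e2: "exp (2 * \<bar>t\<bar>) \<le> exp (2 * t) + exp (- 2 * t)" for t :: real by (cases "t \<ge> 0") auto
  \<comment> \<open>For \<open>\<bar>s\<bar> < 1\<close> the tilt and the linear factor each cost
    one \<open>exp \<bar>u z\<bar>\<close>, up to constants; their product is dominated by two
    exponential moments.\<close>
  have "((\<lambda>s. \<integral>z. F s z \<partial>\<gamma> x) has_real_derivative (\<integral>z. F' 0 z \<partial>\<gamma> x)) (at 0)"
  proof (rule has_real_derivative_integral[where e=1 and w="\<lambda>z. B * (1 + 1 / h) * (exp (2 * u z) + exp (- 2 * u z))"])
    show "integrable (\<gamma> x) (\<lambda>z. B * (1 + 1 / h) * (exp (2 * u z) + exp (- 2 * u z)))"
      using int_exp by (intro integrable_mult_right Bochner_Integration.integrable_add)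
    show "F' 0 \<in> borel_measurable (\<gamma> x)" unfolding F'_def by measurable
    fix s :: real
    show "((\<lambda>s. F s z) has_real_derivative F' s z) (at s)" for z
      unfolding F_def F'_def using h_pos
      by (auto intro!: derivative_eq_intros simp: field_simps)
    assume "\<bar>s - 0\<bar> < 1"
    then have s: "\<bar>s\<bar> < 1" by simp
    show "\<bar>F' s z\<bar> \<le> B * (1 + 1 / h) * (exp (2 * u z) + exp (- 2 * u z))" if z: "z \<in> space (\<gamma> x)" for z
    proof -
      have "\<bar>u z - s / h\<bar> \<le> \<bar>u z\<bar> + 1 / h"
      proof -
        have "\<bar>s / h\<bar> \<le> 1 / h" using s h_pos by (simp add: abs_divide divide_right_mono)
        then show ?thesis using abs_triangle_ineq4[of "u z" "s / h"] by linarith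
      qed
      also have "\<dots> \<le> exp \<bar>u z\<bar> + (1 / h) * exp \<bar>u z\<bar>"
      proof (rule add_mono)
        show "\<bar>u z\<bar> \<le> exp \<bar>u z\<bar>" using exp_ge_add_one_self[of "\<bar>u z\<bar>"] by linarith
        have "1 / h * 1 \<le> 1 / h * exp \<bar>u z\<bar>" using h_pos by (intro mult_left_mono) auto
        then show "1 / h \<le> 1 / h * exp \<bar>u z\<bar>" by simp
      qed
      finally have "\<bar>u z - s / h\<bar> \<le> (1 + 1 / h) * exp \<bar>u z\<bar>" by (simp add: algebra_simps)
      moreover have "\<bar>f z * exp (s * u z - s\<^sup>2 / (2 * h))\<bar> \<le> B * exp \<bar>u z\<bar>"
        unfolding abs_mult using f[of z] z e1[OF s] by (intro mult_mono) auto
      ultimately have "\<bar>F' s z\<bar> \<le> (B * exp \<bar>u z\<bar>) * ((1 + 1 / h) * exp \<bar>u z\<bar>)"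
        unfolding F'_def abs_mult[of _ "u z - s / h"] using B z by (intro mult_mono) auto
      also have "\<dots> = B * (1 + 1 / h) * exp (2 * \<bar>u z\<bar>)"
        by (simp add: exp_double power2_eq_square)
      also have "\<dots> \<le> B * (1 + 1 / h) * (exp (2 * u z) + exp (- 2 * u z))"
        using B z h_pos by (intro mult_left_mono e2) auto
      finally show ?thesis .
    qed
    show "integrable (\<gamma> x) (F s)"
    proof (rule Bochner_Integration.integrable_bound[OF integrable_mult_right[OF int_exp, of B s]])
      show "F s \<in> borel_measurable (\<gamma> x)" unfolding F_def by measurable
      have "\<bar>F s z\<bar> \<le> \<bar>B * exp (s * u z)\<bar>" if z: "z \<in> space (Rd d)" for z
        unfolding F_def abs_mult using f[OF z] B[OF z] h_pos by (intro mult_mono) auto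
      then show "AE z in \<gamma> x. norm (F s z) \<le> norm (B * exp (s * u z))" by (intro AE_I2) simp
    qed
  qed simp
  then have "((\<lambda>s. \<integral>z. f z \<partial>\<gamma> (x(i := x i + s))) has_real_derivative (\<integral>z. f z * u z \<partial>\<gamma> x)) (at 0)"
    by (simp add: shift F'_def)
  then have "((\<lambda>s. \<integral>z. f z \<partial>\<gamma> (x(i := x i + s))) has_real_derivative (\<integral>z. f z * u z \<partial>\<gamma> x)) (at (x i - x i))"
    by simp
  then show ?thesis
    using DERIV_shift[of "\<lambda>t. \<integral>z. f z \<partial>\<gamma> (x(i := t))" _ 0 "x i"] by (simp add: u_def add.commute)
qed

section \<open>Bounds and Lipschitz regularity of Gaussian averages\<close>

lemma heat_bounds:
  fixes f :: "_ \<Rightarrow> real"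
  assumes "f \<in> borel_measurable (Rd d)" "\<And>z. z \<in> space (Rd d) \<Longrightarrow> \<alpha> \<le> f z" "\<And>z. z \<in> space (Rd d) \<Longrightarrow> f z \<le> \<beta>"
  shows "\<alpha> \<le> (\<integral>z. f z \<partial>\<gamma> x)" "(\<integral>z. f z \<partial>\<gamma> x) \<le> \<beta>"
proof -
  interpret prob_space "\<gamma> x" by (rule prob_space_\<gamma>)
  have i: "integrable (\<gamma> x) f"
    using assms by (intro integrable_bounded_\<gamma>[where B="max \<bar>\<alpha>\<bar> \<bar>\<beta>\<bar>"]) (auto simp: abs_le_iff max_def; force)+
  show "\<alpha> \<le> (\<integral>z. f z \<partial>\<gamma> x)" by (rule integral_ge_const[OF i]) (use assms in auto)
  show "(\<integral>z. f z \<partial>\<gamma> x) \<le> \<beta>" by (rule integral_le_const[OF i]) (use assms in auto)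
qed

text \<open>Cauchy--Schwarz for the likelihood ratio of the two Gaussian measures.\<close>

lemma heat_diff_le:
  fixes f :: "_ \<Rightarrow> real"
  assumes [measurable]: "f \<in> borel_measurable (Rd d)"
    and f: "\<And>z. z \<in> space (Rd d) \<Longrightarrow> \<bar>f z\<bar> \<le> B" and B: "0 \<le> B"
  shows "\<bar>(\<integral>w. f w \<partial>\<gamma> y) - (\<integral>w. f w \<partial>\<gamma> z)\<bar> \<le> B * sqrt (exp ((euclid_dist d y z)\<^sup>2 / h) - 1)"
proof -
  interpret prob_space "\<gamma> z" by (rule prob_space_\<gamma>)
  define v where "v i = y i - z i" for i
  define S where "S = (\<Sum>i<d. (v i)\<^sup>2)"
  define \<rho> where "\<rho> w = exp ((\<Sum>i<d. v i * (w i - z i)) / h - S / (2 * h))" for w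
  have [measurable]: "\<rho> \<in> borel_measurable (Rd d)" unfolding \<rho>_def by measurable
  have S: "(euclid_dist d y z)\<^sup>2 = S"
    unfolding euclid_dist_def L2_set_def S_def v_def by (simp add: sum_nonneg)
  have ky: "kern y w = kern z w * \<rho> w" for w
    using kern_shift[where x=z and v=v and z=w] by (simp add: \<rho>_def S_def v_def)
  have 1: "has_bochner_integral (\<gamma> z) \<rho> 1"
    using has_bochner_integral_mult_left[where c="exp (- (S / (2 * h)))", OF has_bochner_integral_exp_\<gamma>[of z v]]
    unfolding S_def[symmetric] mult_exp_exp \<rho>_def by simp
  \<comment> \<open>The square of a tilt by \<open>v\<close> is a tilt by \<open>2 v\<close> with a
    different normalisation.\<close>
  have 2: "has_bochner_integral (\<gamma> z) (\<lambda>w. (\<rho> w)\<^sup>2) (exp (S / h))"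
  proof -
    have "has_bochner_integral (\<gamma> z) (\<lambda>w. exp ((\<Sum>i<d. (2 * v i) * (w i - z i)) / h) * exp (- (S / h)))
       (exp ((\<Sum>i<d. (2 * v i)\<^sup>2) / (2 * h)) * exp (- (S / h)))"
      by (rule has_bochner_integral_mult_left) (rule has_bochner_integral_exp_\<gamma>)
    moreover have "exp ((\<Sum>i<d. (2 * v i)\<^sup>2) / (2 * h)) * exp (- (S / h)) = exp (S / h)"
    proof -
      have "(\<Sum>i<d. (2 * v i)\<^sup>2) = 4 * S" unfolding S_def by (simp add: sum_distrib_left power_mult_distrib)
      then show ?thesis using h_pos by (simp add: exp_add[symmetric] field_simps)
    qed
    moreover have "exp ((\<Sum>i<d. (2 * v i) * (w i - z i)) / h) * exp (- (S / h)) = (\<rho> w)\<^sup>2" for w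
    proof -
      have "(\<Sum>i<d. (2 * v i) * (w i - z i)) = 2 * (\<Sum>i<d. v i * (w i - z i))"
        by (simp add: sum_distrib_left mult.assoc)
      then show ?thesis unfolding \<rho>_def exp_double[symmetric] exp_add[symmetric]
        by (simp add: right_diff_distrib)
    qed
    ultimately show ?thesis by simp
  qed
  note i1 = has_bochner_integral_iff[THEN iffD1, OF 1]
  note i2 = has_bochner_integral_iff[THEN iffD1, OF 2]
  define X where "X w = \<bar>\<rho> w - 1\<bar>" for w
  have X2: "(X w)\<^sup>2 = (\<rho> w)\<^sup>2 - 2 * \<rho> w + 1" for w
    unfolding X_def by (simp add: power2_eq_square algebra_simps)
  have iX: "integrable (\<gamma> z) X" unfolding X_def using i1 by auto
  have iX2: "integrable (\<gamma> z) (\<lambda>w. (X w)\<^sup>2)" unfolding X2 using i1 i2 by auto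
  have "expectation (\<lambda>w. (X w)\<^sup>2) = exp (S / h) - 1"
    unfolding X2 using i1 i2 prob_space by simp
  \<comment> \<open>The second moment of \<open>X\<close> is the chi-square divergence of the two
    Gaussians; nonnegativity of the variance is the Cauchy-Schwarz bound on the first
    moment.\<close>
  moreover have "0 \<le> variance X" by (rule variance_positive)
  ultimately have "(expectation X)\<^sup>2 \<le> exp (S / h) - 1"
    using variance_eq[OF iX iX2] by simp
  then have EX: "expectation X \<le> sqrt (exp (S / h) - 1)" by (rule real_le_rsqrt)
  have if': "integrable (\<gamma> z) f" by (rule integrable_bounded_\<gamma>) (use f in auto)
  have i\<rho>: "integrable (\<gamma> z) (\<lambda>w. f w * \<rho> w)"
  proof (rule Bochner_Integration.integrable_bound[of _ "\<lambda>w. B * \<rho> w"])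
    show "AE w in \<gamma> z. norm (f w * \<rho> w) \<le> norm (B * \<rho> w)"
      using f B by (intro AE_I2) (auto simp: abs_mult intro!: mult_mono)
  qed (use i1 in auto)
  have "(\<integral>w. f w \<partial>\<gamma> y) = (\<integral>w. f w * \<rho> w \<partial>\<gamma> z)"
    by (subst (1 2) integral_\<gamma>) (auto simp: ky mult_ac)
  then have "(\<integral>w. f w \<partial>\<gamma> y) - (\<integral>w. f w \<partial>\<gamma> z) = (\<integral>w. f w * \<rho> w - f w \<partial>\<gamma> z)"
    using i\<rho> if' by simp
  also have "\<bar>\<dots>\<bar> \<le> (\<integral>w. \<bar>f w * \<rho> w - f w\<bar> \<partial>\<gamma> z)" by (rule integral_abs_bound)
  also have "\<dots> \<le> (\<integral>w. B * X w \<partial>\<gamma> z)"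
  proof (rule integral_mono)
    fix w assume "w \<in> space (\<gamma> z)"
    then have "\<bar>f w\<bar> * \<bar>\<rho> w - 1\<bar> \<le> B * \<bar>\<rho> w - 1\<bar>" using f by (intro mult_right_mono) auto
    then show "\<bar>f w * \<rho> w - f w\<bar> \<le> B * X w"
      unfolding X_def abs_mult[symmetric] by (simp add: algebra_simps)
  qed (use i\<rho> if' iX in auto)
  also have "\<dots> = B * expectation X" by simp
  also have "\<dots> \<le> B * sqrt (exp (S / h) - 1)" using EX B by (intro mult_left_mono)
  finally show ?thesis unfolding S .
qed

text \<open>Linearises the previous bound through \<open>exp s - 1 \<le> s * exp s\<close>. Distance
  2 is what two points of a common unit ball need, and it caps \<open>s\<close> by
  \<open>4 / h\<close>.\<close>

lemma heat_Lipschitz: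
  fixes f :: "_ \<Rightarrow> real"
  assumes m: "f \<in> borel_measurable (Rd d)"
    and f: "\<And>z. z \<in> space (Rd d) \<Longrightarrow> \<bar>f z\<bar> \<le> B" and B: "0 \<le> B"
    and le: "euclid_dist d y z \<le> 2"
  shows "\<bar>(\<integral>w. f w \<partial>\<gamma> y) - (\<integral>w. f w \<partial>\<gamma> z)\<bar> \<le> B * sqrt (exp (4 / h) / h) * euclid_dist d y z"
proof -
  let ?t = "euclid_dist d y z"
  have t: "0 \<le> ?t" unfolding euclid_dist_def by simp
  define s where "s = ?t\<^sup>2 / h"
  have s: "0 \<le> s" "s \<le> 4 / h"
    unfolding s_def using t h_pos power_mono[OF le t, of 2] by (auto simp: divide_right_mono)
  have "1 - s \<le> exp (- s)" using exp_ge_add_one_self[of "- s"] by simp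
  then have "(1 - s) * exp s \<le> exp (- s) * exp s" by (intro mult_right_mono) auto
  then have "exp s - 1 \<le> s * exp s" by (simp add: exp_minus algebra_simps)
  also have "\<dots> \<le> s * exp (4 / h)" using s by (intro mult_left_mono) auto
  also have "\<dots> = exp (4 / h) / h * ?t\<^sup>2" by (simp add: s_def)
  finally have "sqrt (exp s - 1) \<le> sqrt (exp (4 / h) / h * ?t\<^sup>2)" by (rule real_sqrt_le_mono)
  also have "\<dots> = sqrt (exp (4 / h) / h) * ?t" using t by (simp only: real_sqrt_mult real_sqrt_abs abs_of_nonneg)
  finally have "B * sqrt (exp s - 1) \<le> B * (sqrt (exp (4 / h) / h) * ?t)" using B by (rule mult_left_mono)
  then show ?thesis using heat_diff_le[OF m f B, of y z] unfolding s_def by (simp add: mult.assoc)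
qed

section \<open>Hypercontractivity of the heat semigroup\<close>

text \<open>Gibbs' variational principle: test the entropy of \<open>exp \<phi>\<close> against the exponentially tilted kernel
  whose mean is that of the normalised density \<open>exp \<phi> / A\<close>; the gradient of \<open>A\<close> is the shift of that mean.\<close>

lemma heat_exp_reverse_log_Sobolev:
  fixes \<phi> :: "_ \<Rightarrow> real"
  assumes [measurable]: "\<phi> \<in> borel_measurable (Rd d)"
    and \<phi>: "\<And>z. z \<in> space (Rd d) \<Longrightarrow> \<bar>\<phi> z\<bar> \<le> L"
  defines "A \<equiv> (\<lambda>x. \<integral>z. exp (\<phi> z) \<partial>\<gamma> x)"
    and "D \<equiv> (\<lambda>i x. \<integral>z. exp (\<phi> z) * ((z i - x i) / h) \<partial>\<gamma> x)"
  shows "h / 2 * (\<Sum>i<d. (D i x / A x)\<^sup>2) \<le> (\<integral>z. exp (\<phi> z) * \<phi> z \<partial>\<gamma> x) / A x - ln (A x)"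
proof -
  define u where "u z = exp (\<phi> z)" for z
  have [measurable]: "u \<in> borel_measurable (Rd d)" unfolding u_def by measurable
  have ub: "\<bar>u z\<bar> \<le> exp L" "\<bar>u z * \<phi> z\<bar> \<le> exp L * L" if "z \<in> space (Rd d)" for z
    using \<phi>[OF that] by (auto simp: u_def abs_mult intro!: mult_mono)
  have iu: "integrable (\<gamma> x) u" "integrable (\<gamma> x) (\<lambda>z. u z * \<phi> z)"
    using ub by (auto intro!: integrable_bounded_\<gamma>)
  have Apos: "A x > 0"
  proof -
    have "exp (- L) \<le> u z" if "z \<in> space (Rd d)" for z
      using \<phi>[OF that] by (simp add: u_def abs_le_iff)
    moreover have "u z \<le> exp L" if "z \<in> space (Rd d)" for z using ub[OF that] by linarith
    ultimately have "exp (- L) \<le> A x" unfolding A_def u_def[symmetric] by (intro heat_bounds) auto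
    then show ?thesis using exp_gt_zero[of "- L"] by linarith
  qed
  \<comment> \<open>\<open>v\<close> is the mean displacement from \<open>x\<close> under the
    normalised density \<open>u / A x\<close>. With it, \<open>b / A x\<close> is the density of the
    kernel centred at \<open>x + v\<close> relative to the kernel at \<open>x\<close>, and
    \<open>s\<close> is the logarithm of the normalising constant.\<close>
  define v where "v i = h * (D i x / A x)" for i
  define s where "s = (\<Sum>i<d. (v i)\<^sup>2) / (2 * h)"
  define l where "l z = (\<Sum>i<d. v i * (z i - x i)) / h - s" for z
  define b where "b z = A x * exp (l z)" for z
  have b: "has_bochner_integral (\<gamma> x) b (A x)"
    using has_bochner_integral_mult_left[where c="A x * exp (- s)", OF has_bochner_integral_exp_\<gamma>[of x v]]
    unfolding s_def[symmetric] mult.left_commute[of "exp _" "A x"] mult_exp_exp b_def l_def by simp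
  note ib = has_bochner_integral_iff[THEN iffD1, OF b]
  have iD: "integrable (\<gamma> x) (\<lambda>z. u z * ((z i - x i) / h))" if "i < d" for i
    by (rule integrable_component_\<gamma>[OF that _ ub(1)]) auto
  have ul: "u z * l z = (\<Sum>i<d. v i * (u z * ((z i - x i) / h))) - s * u z" for z
    unfolding l_def by (simp add: algebra_simps sum_distrib_left sum_divide_distrib)
  have iul: "integrable (\<gamma> x) (\<lambda>z. u z * l z)"
    unfolding ul
    by (intro Bochner_Integration.integrable_diff Bochner_Integration.integrable_sum integrable_mult_right iD iu) auto
  have "(\<integral>z. u z * l z \<partial>\<gamma> x) = (\<Sum>i<d. v i * D i x) - s * A x"
  proof -
    have "integrable (\<gamma> x) (\<lambda>z. v i * (u z * ((z i - x i) / h)))" if "i \<in> {..<d}" for i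
      using that by (intro integrable_mult_right iD) auto
    moreover have "(\<integral>z. (\<Sum>i<d. v i * (u z * ((z i - x i) / h))) \<partial>\<gamma> x) = (\<Sum>i<d. v i * D i x)"
      using calculation
      by (subst Bochner_Integration.integral_sum) (simp_all only: integral_mult_right_zero D_def u_def)
    ultimately show ?thesis unfolding ul using iu
      by (subst Bochner_Integration.integral_diff) (auto simp: A_def u_def[symmetric] intro!: Bochner_Integration.integrable_sum)
  qed
  also have "(\<Sum>i<d. v i * D i x) = h * A x * (\<Sum>i<d. (D i x / A x)\<^sup>2)"
    unfolding v_def sum_distrib_left using Apos by (intro sum.cong) (auto simp: power2_eq_square)
  also have "s * A x = h / 2 * A x * (\<Sum>i<d. (D i x / A x)\<^sup>2)"
  proof -
    have "(\<Sum>i<d. (v i)\<^sup>2) = h\<^sup>2 * (\<Sum>i<d. (D i x / A x)\<^sup>2)"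
      by (simp only: v_def power_mult_distrib sum_distrib_left)
    then show ?thesis unfolding s_def using h_pos by (simp add: power2_eq_square[of h])
  qed
  \<comment> \<open>The linear part of \<open>l\<close> contributes \<open>h\<close> times the
    squared gradient of \<open>ln A\<close>, and the normalisation \<open>s\<close> takes back half
    of it.\<close>
  finally have I: "(\<integral>z. u z * l z \<partial>\<gamma> x) = A x * (h / 2 * (\<Sum>i<d. (D i x / A x)\<^sup>2))"
    by (simp add: algebra_simps)
  \<comment> \<open>Pointwise this is \<open>ln t \<le> t - 1\<close> at
    \<open>t = b z / u z\<close>. As \<open>u\<close> and \<open>b\<close> both have integral
    \<open>A x\<close>, the two correction terms cancel after integration.\<close>
  have "(\<integral>z. u z * l z + u z * ln (A x) + u z - b z \<partial>\<gamma> x) \<le> (\<integral>z. u z * \<phi> z \<partial>\<gamma> x)"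
  proof (rule integral_mono)
    fix z
    have "u z > 0" "b z > 0" using Apos by (auto simp: u_def b_def)
    then have "ln (b z / u z) \<le> b z / u z - 1" by (intro ln_le_minus_one) auto
    moreover have "ln (b z / u z) = ln (A x) + l z - \<phi> z"
      using Apos \<open>b z > 0\<close> by (simp add: ln_div ln_mult b_def u_def)
    ultimately have "u z * (ln (A x) + l z - \<phi> z) \<le> u z * (b z / u z - 1)"
      using \<open>u z > 0\<close> by (intro mult_left_mono) auto
    then show "u z * l z + u z * ln (A x) + u z - b z \<le> u z * \<phi> z"
      using \<open>u z > 0\<close> by (simp add: algebra_simps)
  qed (use iu iul ib in auto)
  also have "(\<integral>z. u z * l z + u z * ln (A x) + u z - b z \<partial>\<gamma> x) =
      (\<integral>z. u z * l z \<partial>\<gamma> x) + A x * ln (A x)"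
  proof -
    have "A x = (\<integral>z. u z \<partial>\<gamma> x)" by (simp add: A_def u_def)
    then show ?thesis using iu iul ib by simp
  qed
  finally have "A x * (h / 2 * (\<Sum>i<d. (D i x / A x)\<^sup>2) + ln (A x)) \<le> (\<integral>z. u z * \<phi> z \<partial>\<gamma> x)"
    unfolding I by (simp add: algebra_simps)
  then show ?thesis using Apos by (simp add: u_def pos_le_divide_eq mult.commute le_diff_eq)
qed

lemma heat_exp_deriv:
  fixes \<phi> :: "_ \<Rightarrow> real"
  assumes [measurable]: "\<phi> \<in> borel_measurable (Rd d)"
    and \<phi>: "\<And>z. z \<in> space (Rd d) \<Longrightarrow> \<bar>\<phi> z\<bar> \<le> L"
  shows "((\<lambda>r. \<integral>z. exp (r * \<phi> z) \<partial>\<gamma> x) has_real_derivative (\<integral>z. exp (r * \<phi> z) * \<phi> z \<partial>\<gamma> x)) (at r)"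
proof (rule has_real_derivative_integral[where e=1 and w="\<lambda>z. exp ((\<bar>r\<bar> + 1) * L) * L"])
  interpret prob_space "\<gamma> x" by (rule prob_space_\<gamma>)
  show "integrable (\<gamma> x) (\<lambda>z. exp ((\<bar>r\<bar> + 1) * L) * L)" by simp
  fix s :: real assume s: "\<bar>s - r\<bar> < 1"
  have e: "exp (s * \<phi> z) \<le> exp ((\<bar>r\<bar> + 1) * L)" if "z \<in> space (Rd d)" for z
  proof -
    have "s * \<phi> z \<le> \<bar>s\<bar> * \<bar>\<phi> z\<bar>" by (metis abs_ge_self abs_mult)
    also have "\<dots> \<le> (\<bar>r\<bar> + 1) * L" using s \<phi>[OF that] by (intro mult_mono) auto
    finally show ?thesis by simp
  qed
  show "integrable (\<gamma> x) (\<lambda>z. exp (s * \<phi> z))"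
    by (rule integrable_bounded_\<gamma>[where B="exp ((\<bar>r\<bar> + 1) * L)"]) (use e in auto)
  show "((\<lambda>s. exp (s * \<phi> z)) has_real_derivative exp (s * \<phi> z) * \<phi> z) (at s)" for z
    by (auto intro!: derivative_eq_intros)
  show "\<bar>exp (s * \<phi> z) * \<phi> z\<bar> \<le> exp ((\<bar>r\<bar> + 1) * L) * L" if "z \<in> space (\<gamma> x)" for z
    unfolding abs_mult using e[of z] \<phi>[of z] that by (intro mult_mono) auto
qed auto

section \<open>Gaussian averages of \<open>exp (r * \<phi> z)\<close> as functions of
  \<open>r\<close> and of the centre\<close>

context
  fixes \<phi> :: "(nat \<Rightarrow> real) \<Rightarrow> real" and L :: real
  assumes \<phi>_meas [measurable]: "\<phi> \<in> borel_measurable (Rd d)"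
    and \<phi>_le: "\<And>z. z \<in> space (Rd d) \<Longrightarrow> \<bar>\<phi> z\<bar> \<le> L"
begin

definition heat_exp :: "real \<Rightarrow> (nat \<Rightarrow> real) \<Rightarrow> real" where
  "heat_exp r x = (\<integral>z. exp (r * \<phi> z) \<partial>\<gamma> x)"

definition heat_exp' :: "real \<Rightarrow> (nat \<Rightarrow> real) \<Rightarrow> real" where
  "heat_exp' r x = (\<integral>z. exp (r * \<phi> z) * \<phi> z \<partial>\<gamma> x)"

text \<open>The partial derivative of \<open>heat_exp r\<close> in the centre, with the derivative
  carried by the kernel because \<open>\<phi>\<close> is only measurable.\<close>

definition heat_exp_grad :: "real \<Rightarrow> nat \<Rightarrow> (nat \<Rightarrow> real) \<Rightarrow> real" where
  "heat_exp_grad r i x = (\<integral>z. exp (r * \<phi> z) * ((z i - x i) / h) \<partial>\<gamma> x)"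

lemma L_nonneg: "0 \<le> L"
proof -
  interpret prob_space "\<gamma> x" for x by (rule prob_space_\<gamma>)
  obtain z where "z \<in> space (Rd d)" using not_empty by auto
  then show ?thesis using \<phi>_le[of z] by linarith
qed

lemma r\<phi>_le: "z \<in> space (Rd d) \<Longrightarrow> \<bar>r * \<phi> z\<bar> \<le> \<bar>r\<bar> * L"
  using \<phi>_le[of z] by (simp add: abs_mult mult_left_mono)

lemma exp_r\<phi>_bounds:
  assumes "z \<in> space (Rd d)"
  shows "exp (- (\<bar>r\<bar> * L)) \<le> exp (r * \<phi> z)" "exp (r * \<phi> z) \<le> exp (\<bar>r\<bar> * L)"
  using r\<phi>_le[OF assms, of r] by (auto simp: abs_le_iff)

lemma exp_r\<phi>_abs: "z \<in> space (Rd d) \<Longrightarrow> \<bar>exp (r * \<phi> z)\<bar> \<le> exp (\<bar>r\<bar> * L)"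
  using exp_r\<phi>_bounds[of z r] by simp

lemma heat_exp_bounds: "exp (- (\<bar>r\<bar> * L)) \<le> heat_exp r x" "heat_exp r x \<le> exp (\<bar>r\<bar> * L)"
proof -
  have [measurable]: "(\<lambda>z. exp (r * \<phi> z)) \<in> borel_measurable (Rd d)" by measurable
  show "exp (- (\<bar>r\<bar> * L)) \<le> heat_exp r x" "heat_exp r x \<le> exp (\<bar>r\<bar> * L)"
    unfolding heat_exp_def using exp_r\<phi>_bounds
    by (auto intro!: heat_bounds[where \<alpha>="exp (- (\<bar>r\<bar> * L))" and \<beta>="exp (\<bar>r\<bar> * L)"])
qed

lemma heat_exp_pos: "0 < heat_exp r x"
  using heat_exp_bounds(1)[of r x] exp_gt_zero[of "- (\<bar>r\<bar> * L)"] by linarith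

lemma ln_heat_exp_abs: "\<bar>ln (heat_exp r x)\<bar> \<le> \<bar>r\<bar> * L"
  using heat_exp_bounds[of r x] heat_exp_pos[of r x]
    ln_le_cancel_iff[of "exp (- (\<bar>r\<bar> * L))" "heat_exp r x"] ln_le_cancel_iff[of "heat_exp r x" "exp (\<bar>r\<bar> * L)"]
  by (simp add: abs_le_iff)

text \<open>The quotient is the average of \<open>\<phi>\<close> under the tilted probability
  proportional to \<open>exp (r * \<phi> z)\<close>, so it inherits the bound on
  \<open>\<phi>\<close>, uniformly in \<open>r\<close>.\<close>

lemma heat_exp'_abs: "\<bar>heat_exp' r x / heat_exp r x\<bar> \<le> L"
proof -
  have i: "integrable (\<gamma> x) (\<lambda>z. exp (r * \<phi> z))"
    by (rule integrable_bounded_\<gamma>) (use exp_r\<phi>_abs in auto)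
  have "\<bar>heat_exp' r x\<bar> \<le> (\<integral>z. \<bar>exp (r * \<phi> z) * \<phi> z\<bar> \<partial>\<gamma> x)"
    unfolding heat_exp'_def by (rule integral_abs_bound)
  also have "\<dots> \<le> (\<integral>z. L * exp (r * \<phi> z) \<partial>\<gamma> x)"
  proof (rule integral_mono)
    show "integrable (\<gamma> x) (\<lambda>z. \<bar>exp (r * \<phi> z) * \<phi> z\<bar>)"
    proof (rule integrable_bounded_\<gamma>[where B="exp (\<bar>r\<bar> * L) * L"])
      show "\<bar>\<bar>exp (r * \<phi> z) * \<phi> z\<bar>\<bar> \<le> exp (\<bar>r\<bar> * L) * L" if "z \<in> space (Rd d)" for z
        unfolding abs_abs unfolding abs_mult[of "exp _"]
        using exp_r\<phi>_abs[OF that, of r] \<phi>_le[OF that] by (intro mult_mono) auto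
    qed auto
    show "integrable (\<gamma> x) (\<lambda>z. L * exp (r * \<phi> z))" using i by simp
    show "\<bar>exp (r * \<phi> z) * \<phi> z\<bar> \<le> L * exp (r * \<phi> z)" if "z \<in> space (\<gamma> x)" for z
      using \<phi>_le[of z] that by (simp add: abs_mult mult.commute mult_right_mono)
  qed
  also have "\<dots> = L * heat_exp r x" unfolding heat_exp_def by simp
  finally show ?thesis using heat_exp_pos[of r x] by (simp add: abs_divide divide_le_eq)
qed

lemma measurable_heat_exp [measurable]:
  "heat_exp r \<in> borel_measurable (Rd d)" "heat_exp' r \<in> borel_measurable (Rd d)"
  unfolding heat_exp_def[abs_def] heat_exp'_def[abs_def] by measurable

text \<open>The integrand involves the centre \<open>x\<close> itself. Splitting
  \<open>z i - x i\<close> leaves averages of functions of \<open>z\<close> alone, whose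
  measurability in the centre is known.\<close>

lemma measurable_heat_exp_grad [measurable]:
  assumes "i < d"
  shows "heat_exp_grad r i \<in> borel_measurable (Rd d)"
proof -
  have [measurable]: "(\<lambda>x. x i) \<in> borel_measurable (Rd d)" using assms by measurable
  have *: "heat_exp_grad r i x = (\<integral>z. exp (r * \<phi> z) / h * z i \<partial>\<gamma> x) - heat_exp r x / h * x i" for x
  proof -
    have B: "\<bar>exp (r * \<phi> z)\<bar> \<le> exp (\<bar>r\<bar> * L)" if "z \<in> space (Rd d)" for z using exp_r\<phi>_abs[OF that] .
    have 1: "integrable (\<gamma> x) (\<lambda>z. exp (r * \<phi> z) * ((z i - x i) / h))"
      by (rule integrable_component_\<gamma>[OF assms _ B]) auto
    have 2: "integrable (\<gamma> x) (\<lambda>z. exp (r * \<phi> z))" by (rule integrable_bounded_\<gamma>[OF _ B]) auto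
    have "(\<lambda>z. exp (r * \<phi> z) / h * z i) = (\<lambda>z. exp (r * \<phi> z) * ((z i - x i) / h) + x i / h * exp (r * \<phi> z))"
      using h_pos by (auto simp: algebra_simps diff_divide_distrib)
    then show ?thesis using 1 2 h_pos by (simp add: heat_exp_grad_def heat_exp_def)
  qed
  show ?thesis unfolding * by measurable
qed

text \<open>With \<open>ln (heat_exp r x) = r * \<psi>\<^sub>r(x)\<close>, this is
  \<open>r\<^sup>2\<close> times the inequality between
  \<open>\<partial>\<^sub>r \<psi>\<^sub>r\<close> and the squared gradient of
  \<open>\<psi>\<^sub>r\<close>.\<close>

lemma reverse_log_Sobolev_heat_exp:
  "h / 2 * (\<Sum>i<d. (heat_exp_grad r i x / heat_exp r x)\<^sup>2)
     \<le> r * (heat_exp' r x / heat_exp r x) - ln (heat_exp r x)"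
  using heat_exp_reverse_log_Sobolev[of "\<lambda>z. r * \<phi> z" "\<bar>r\<bar> * L" x] r\<phi>_le[of _ r]
  unfolding heat_exp_def heat_exp'_def heat_exp_grad_def
  by (simp add: mult.left_commute[of _ r])

lemma heat_exp_partial_deriv:
  assumes "i < d"
  shows "((\<lambda>t. heat_exp r (x(i := t))) has_real_derivative heat_exp_grad r i x) (at (x i))"
  unfolding heat_exp_def heat_exp_grad_def
  by (rule heat_deriv[OF assms _ exp_r\<phi>_abs[of _ r]]) auto

lemma heat_exp_exponent_deriv:
  "((\<lambda>r. heat_exp r x) has_real_derivative heat_exp' r x) (at r)"
  unfolding heat_exp_def heat_exp'_def by (rule heat_exp_deriv[OF _ \<phi>_le]) auto

text \<open>Makes the test function admissible in \<open>LSI\<close>. The average stays in the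
  compact interval from \<open>\<alpha>\<close> to \<open>\<beta>\<close> of positive numbers, on
  which the derivative of \<open>exp (c * ln a)\<close> is at most \<open>N\<close>; so the
  Lipschitz bound of the average on unit balls is only multiplied by \<open>N\<close>.\<close>

lemma locally_Lipschitz_heat_exp_powr: "locally_Lipschitz d (\<lambda>x. exp (c * ln (heat_exp r x)))"
proof -
  define \<alpha> where "\<alpha> = exp (- (\<bar>r\<bar> * L))"
  define \<beta> where "\<beta> = exp (\<bar>r\<bar> * L)"
  define N where "N = exp (\<bar>c\<bar> * (\<bar>r\<bar> * L)) * (\<bar>c\<bar> / \<alpha>)"
  have N: "N \<ge> 0" unfolding N_def \<alpha>_def by simp
  have *: "\<bar>exp (c * ln (heat_exp r y)) - exp (c * ln (heat_exp r z))\<bar>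
      \<le> N * (\<beta> * sqrt (exp (4 / h) / h)) * euclid_dist d y z"
    if "euclid_dist d x y < 1" "euclid_dist d x z < 1" for x y z
  proof -
    note that
    moreover have "euclid_dist d y z \<le> euclid_dist d x y + euclid_dist d x z"
      unfolding euclid_dist_def
    proof -
      have "L2_set (\<lambda>i. y i - z i) {..<d} = L2_set (\<lambda>i. (y i - x i) + (x i - z i)) {..<d}" by simp
      also have "\<dots> \<le> L2_set (\<lambda>i. y i - x i) {..<d} + L2_set (\<lambda>i. x i - z i) {..<d}" by (rule L2_set_triangle_ineq)
      also have "L2_set (\<lambda>i. y i - x i) {..<d} = L2_set (\<lambda>i. x i - y i) {..<d}"
        unfolding L2_set_def by (simp add: power2_commute)
      finally show "L2_set (\<lambda>i. y i - z i) {..<d} \<le> L2_set (\<lambda>i. x i - y i) {..<d} + L2_set (\<lambda>i. x i - z i) {..<d}" .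
    qed
    ultimately have yz: "euclid_dist d y z \<le> 2" by simp
    have "norm (exp (c * ln (heat_exp r y)) - exp (c * ln (heat_exp r z))) \<le> N * norm (heat_exp r y - heat_exp r z)"
    proof (rule field_differentiable_bound[where S="{\<alpha>..\<beta>}" and f'="\<lambda>a. exp (c * ln a) * (c / a)"])
      fix a assume a: "a \<in> {\<alpha>..\<beta>}"
      then have a0: "a > 0" using less_le_trans[of 0 \<alpha> a] by (simp add: \<alpha>_def)
      show "((\<lambda>a. exp (c * ln a)) has_real_derivative exp (c * ln a) * (c / a)) (at a within {\<alpha>..\<beta>})"
        using a0 by (auto intro!: derivative_eq_intros)
      have "\<bar>ln a\<bar> \<le> \<bar>r\<bar> * L"
        using a a0 ln_le_cancel_iff[of \<alpha> a] ln_le_cancel_iff[of a \<beta>] by (simp add: \<alpha>_def \<beta>_def abs_le_iff)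
      then have "\<bar>c * ln a\<bar> \<le> \<bar>c\<bar> * (\<bar>r\<bar> * L)" unfolding abs_mult by (intro mult_left_mono) auto
      then have "exp (c * ln a) \<le> exp (\<bar>c\<bar> * (\<bar>r\<bar> * L))" by (simp add: abs_le_iff)
      moreover have "\<bar>c\<bar> / a \<le> \<bar>c\<bar> / \<alpha>" using a a0 by (intro divide_left_mono) (auto simp: \<alpha>_def)
      ultimately show "norm (exp (c * ln a) * (c / a)) \<le> N"
        unfolding N_def real_norm_def abs_mult abs_divide using a0 by (intro mult_mono) auto
    qed (use heat_exp_bounds in \<open>auto simp: \<alpha>_def \<beta>_def\<close>)
    also have "norm (heat_exp r y - heat_exp r z) \<le> \<beta> * sqrt (exp (4 / h) / h) * euclid_dist d y z"
      unfolding heat_exp_def real_norm_def \<beta>_def by (rule heat_Lipschitz[OF _ exp_r\<phi>_abs _ yz]) auto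
    finally show ?thesis
      using N by (simp add: mult_left_mono mult.assoc)
  qed
  show ?thesis
    unfolding locally_Lipschitz_def
    by (intro ballI exI[of _ "1::real"] conjI exI[of _ "N * (\<beta> * sqrt (exp (4 / h) / h))"] impI) (auto intro: *)
qed

lemma grad_sq_heat_exp_powr:
  "grad_sq d (\<lambda>x. exp (c * ln (heat_exp r x))) x =
     exp (2 * c * ln (heat_exp r x)) * c\<^sup>2 * (\<Sum>i<d. (heat_exp_grad r i x / heat_exp r x)\<^sup>2)"
proof -
  have "deriv (\<lambda>t. exp (c * ln (heat_exp r (x(i := t))))) (x i) =
      exp (c * ln (heat_exp r x)) * c * (heat_exp_grad r i x / heat_exp r x)" if "i < d" for i
    using heat_exp_pos
    by (intro DERIV_imp_deriv) (auto intro!: derivative_eq_intros heat_exp_partial_deriv[OF that])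
  then have "grad_sq d (\<lambda>x. exp (c * ln (heat_exp r x))) x =
      (\<Sum>i<d. (exp (c * ln (heat_exp r x)) * c * (heat_exp_grad r i x / heat_exp r x))\<^sup>2)"
    unfolding grad_sq_def by simp
  also have "\<dots> = (exp (c * ln (heat_exp r x)))\<^sup>2 * c\<^sup>2 * (\<Sum>i<d. (heat_exp_grad r i x / heat_exp r x)\<^sup>2)"
    unfolding power_mult_distrib sum_distrib_left by (simp add: power_mult_distrib)
  finally show ?thesis by (simp add: exp_double[symmetric] mult.assoc)
qed

section \<open>Monotonicity along the interpolation in \<open>r\<close>\<close>

context
  fixes \<pi> :: "(nat \<Rightarrow> real) measure" and C p :: real
  assumes prob_\<pi>: "prob_space \<pi>" and sets_\<pi>: "sets \<pi> = sets (Rd d)"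
    and LSI: "LSI d \<pi> C" and C_pos: "C > 0" and p: "1 \<le> p"
begin

interpretation \<pi>: prob_space \<pi> by (rule prob_\<pi>)

lemma measurable_\<pi>: "measurable \<pi> N = measurable (Rd d) N"
  by (intro measurable_cong_sets sets_\<pi> refl)

text \<open>With \<open>P exp(r \<phi>) = exp(r \<psi>\<^sub>r)\<close> and \<open>a(r) = r b(r)\<close>, the integrand of \<open>\<Lambda>\<close> is \<open>exp(a(r) \<psi>\<^sub>r)\<close>.\<close>

private definition \<eta> :: real where "\<eta> = h / C"

private definition b :: "real \<Rightarrow> real" where "b r = p * (1 + \<eta>) / r - \<eta>"

private definition b' :: "real \<Rightarrow> real" where "b' r = - (p * (1 + \<eta>) / r\<^sup>2)"

private definition \<Lambda> :: "real \<Rightarrow> real" where "\<Lambda> r = (\<integral>x. exp (b r * ln (heat_exp r x)) \<partial>\<pi>)"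

private definition \<Lambda>' :: "real \<Rightarrow> real" where
  "\<Lambda>' r = (\<integral>x. exp (b r * ln (heat_exp r x)) *
      (b' r * ln (heat_exp r x) + b r * (heat_exp' r x / heat_exp r x)) \<partial>\<pi>)"

private lemma \<eta>_pos: "\<eta> > 0" unfolding \<eta>_def using h_pos C_pos by simp

private lemma exp_powr_bound: "exp (c * ln (heat_exp r x)) \<le> exp (\<bar>c\<bar> * (\<bar>r\<bar> * L))"
proof -
  have "c * ln (heat_exp r x) \<le> \<bar>c\<bar> * \<bar>ln (heat_exp r x)\<bar>" by (metis abs_ge_self abs_mult)
  also have "\<dots> \<le> \<bar>c\<bar> * (\<bar>r\<bar> * L)" using ln_heat_exp_abs by (intro mult_left_mono) auto
  finally show ?thesis by simp
qed

private lemma integrable_bounded_\<pi>: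
  fixes f :: "_ \<Rightarrow> real"
  assumes "f \<in> borel_measurable (Rd d)" "\<And>x. \<bar>f x\<bar> \<le> B"
  shows "integrable \<pi> f"
  using assms by (intro \<pi>.integrable_const_bound[where B=B]) (auto simp: measurable_\<pi>)

private lemma integrable_exp_powr: "integrable \<pi> (\<lambda>x. exp (c * ln (heat_exp r x)))"
  by (rule integrable_bounded_\<pi>[where B="exp (\<bar>c\<bar> * (\<bar>r\<bar> * L))"]) (auto simp only: abs_exp_cancel exp_powr_bound, auto)

private lemma \<Lambda>_deriv:
  assumes r: "1 \<le> r"
  shows "(\<Lambda> has_real_derivative \<Lambda>' r) (at r)"
  unfolding \<Lambda>_def[abs_def] \<Lambda>'_def
proof (rule has_real_derivative_integral[where e="1/2" and
    w="\<lambda>x. exp ((2 * (p * (1 + \<eta>)) + \<eta>) * ((r + 1) * L)) *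
      ((4 * (p * (1 + \<eta>))) * ((r + 1) * L) + (2 * (p * (1 + \<eta>)) + \<eta>) * L)"])
  show "(\<lambda>x. exp (b r * ln (heat_exp r x)) *
         (b' r * ln (heat_exp r x) + b r * (heat_exp' r x / heat_exp r x))) \<in> borel_measurable \<pi>"
    unfolding measurable_\<pi> by measurable
  fix s :: real
  assume "\<bar>s - r\<bar> < 1 / 2"
  \<comment> \<open>As \<open>r \<ge> 1\<close>, the radius 1/2 keeps \<open>s\<close> away from the
    pole of \<open>b\<close> at 0; this is where the factors 2 and 4 in the dominating constant come
    from.\<close>
  then have s: "s \<ge> 1 / 2" "s \<le> r + 1" using r by (auto simp: abs_if split: if_splits)
  have \<kappa>: "p * (1 + \<eta>) \<ge> 0" using p \<eta>_pos by simp
  have bs: "\<bar>b s\<bar> \<le> 2 * (p * (1 + \<eta>)) + \<eta>"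
  proof -
    have "p * (1 + \<eta>) / s \<le> p * (1 + \<eta>) / (1 / 2)" using s \<kappa> by (intro divide_left_mono) auto
    moreover have "0 \<le> p * (1 + \<eta>) / s" using s \<kappa> by simp
    ultimately show ?thesis unfolding b_def using \<eta>_pos by (simp add: abs_le_iff)
  qed
  have b's: "\<bar>b' s\<bar> \<le> 4 * (p * (1 + \<eta>))"
  proof -
    have "(1 / 2)\<^sup>2 \<le> s\<^sup>2" using s by (intro power_mono) auto
    then have "p * (1 + \<eta>) / s\<^sup>2 \<le> p * (1 + \<eta>) / (1 / 2)\<^sup>2" using s \<kappa> by (intro divide_left_mono) auto
    moreover have "0 \<le> p * (1 + \<eta>) / s\<^sup>2" using \<kappa> by simp
    ultimately show ?thesis unfolding b'_def by (simp add: power2_eq_square)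
  qed
  have Ks: "\<bar>ln (heat_exp s x)\<bar> \<le> (r + 1) * L" for x
  proof -
    have "\<bar>s\<bar> * L \<le> (r + 1) * L" using s L_nonneg by (intro mult_right_mono) auto
    then show ?thesis using ln_heat_exp_abs[of s x] by linarith
  qed
  show "integrable \<pi> (\<lambda>x. exp (b s * ln (heat_exp s x)))" by (rule integrable_exp_powr)
  show "((\<lambda>s. exp (b s * ln (heat_exp s x))) has_real_derivative
      exp (b s * ln (heat_exp s x)) * (b' s * ln (heat_exp s x) + b s * (heat_exp' s x / heat_exp s x))) (at s)" for x
  proof -
    have "(b has_real_derivative b' s) (at s)"
      unfolding b_def[abs_def] b'_def using s
      by (auto intro!: derivative_eq_intros simp: power2_eq_square)
    then show ?thesis using heat_exp_pos[of s x]
      by (auto intro!: derivative_eq_intros heat_exp_exponent_deriv simp: mult.commute)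
  qed
  show "\<bar>exp (b s * ln (heat_exp s x)) * (b' s * ln (heat_exp s x) + b s * (heat_exp' s x / heat_exp s x))\<bar>
     \<le> exp ((2 * (p * (1 + \<eta>)) + \<eta>) * ((r + 1) * L)) *
      ((4 * (p * (1 + \<eta>))) * ((r + 1) * L) + (2 * (p * (1 + \<eta>)) + \<eta>) * L)" for x
  proof -
    have "b s * ln (heat_exp s x) \<le> \<bar>b s\<bar> * \<bar>ln (heat_exp s x)\<bar>" by (metis abs_ge_self abs_mult)
    also have "\<dots> \<le> (2 * (p * (1 + \<eta>)) + \<eta>) * ((r + 1) * L)" by (intro mult_mono bs Ks) (use \<kappa> \<eta>_pos in auto)
    finally have 1: "\<bar>exp (b s * ln (heat_exp s x))\<bar> \<le> exp ((2 * (p * (1 + \<eta>)) + \<eta>) * ((r + 1) * L))" by simp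
    have "\<bar>b' s * ln (heat_exp s x)\<bar> \<le> (4 * (p * (1 + \<eta>))) * ((r + 1) * L)"
      unfolding abs_mult by (intro mult_mono b's Ks) (use \<kappa> in auto)
    moreover have "\<bar>b s * (heat_exp' s x / heat_exp s x)\<bar> \<le> (2 * (p * (1 + \<eta>)) + \<eta>) * L"
      unfolding abs_mult[of "b s"] by (intro mult_mono bs heat_exp'_abs) (use \<kappa> \<eta>_pos in auto)
    ultimately have 2: "\<bar>b' s * ln (heat_exp s x) + b s * (heat_exp' s x / heat_exp s x)\<bar>
        \<le> (4 * (p * (1 + \<eta>))) * ((r + 1) * L) + (2 * (p * (1 + \<eta>)) + \<eta>) * L"
      by linarith
    show ?thesis unfolding abs_mult[of "exp _"] by (intro mult_mono 1 2) auto
  qed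
qed auto

private lemma \<Lambda>_pos: "0 < \<Lambda> r"
proof -
  have "exp (- (\<bar>b r\<bar> * (\<bar>r\<bar> * L))) \<le> \<Lambda> r"
    unfolding \<Lambda>_def
  proof (rule \<pi>.integral_ge_const[OF integrable_exp_powr], rule AE_I2)
    fix x
    have "- (b r * ln (heat_exp r x)) \<le> \<bar>b r\<bar> * \<bar>ln (heat_exp r x)\<bar>" by (metis abs_ge_minus_self abs_mult)
    also have "\<dots> \<le> \<bar>b r\<bar> * (\<bar>r\<bar> * L)" using ln_heat_exp_abs by (intro mult_left_mono) auto
    finally show "exp (- (\<bar>b r\<bar> * (\<bar>r\<bar> * L))) \<le> exp (b r * ln (heat_exp r x))" by simp
  qed
  then show ?thesis using exp_gt_zero[of "- (\<bar>b r\<bar> * (\<bar>r\<bar> * L))"] by linarith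
qed

text \<open>The left-hand side is \<open>a(r)\<^sup>2 \<Lambda>(r)\<close> times the derivative of \<open>ln \<Lambda>(r) / a(r)\<close>. The reverse inequality for the
  kernel produces \<open>2 h \<integral> |\<nabla> f|\<^sup>2 d\<pi>\<close> with \<open>f = exp(a(r) \<psi>\<^sub>r / 2)\<close>, which pays for \<open>\<eta>\<close> times the entropy of \<open>f\<^sup>2\<close>
  exactly when \<open>\<eta> = h / C\<close>.\<close>

private lemma entropy_production:
  assumes r: "1 \<le> r"
  shows "0 \<le> r * b r * \<Lambda>' r + \<eta> * (\<Lambda> r * ln (\<Lambda> r))"
proof -
  define K where "K x = ln (heat_exp r x)" for x
  define K' where "K' x = heat_exp' r x / heat_exp r x" for x
  define S where "S x = (\<Sum>i<d. (heat_exp_grad r i x / heat_exp r x)\<^sup>2)" for x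
  define G where "G x = exp (b r * K x)" for x
  have [measurable]: "K \<in> borel_measurable (Rd d)" "K' \<in> borel_measurable (Rd d)" "G \<in> borel_measurable (Rd d)"
    "S \<in> borel_measurable (Rd d)"
    unfolding K_def[abs_def] K'_def[abs_def] G_def[abs_def] S_def[abs_def] by measurable
  define f where "f x = exp (b r / 2 * ln (heat_exp r x))" for x
  have f2: "(f x)\<^sup>2 = G x" for x
    unfolding f_def G_def K_def exp_double[symmetric] by simp
  have lnf2: "ln ((f x)\<^sup>2) = b r * K x" for x unfolding f2 G_def by simp
  have grad: "grad_sq d f x = (b r)\<^sup>2 / 4 * (G x * S x)" for x
    unfolding f_def grad_sq_heat_exp_powr G_def K_def S_def by (simp add: power_divide)
  have SK: "h / 2 * S x \<le> r * K' x - K x" for x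
    unfolding S_def K'_def K_def by (rule reverse_log_Sobolev_heat_exp)
  have KL: "\<bar>K x\<bar> \<le> r * L" "\<bar>K' x\<bar> \<le> L" for x
    unfolding K_def K'_def using ln_heat_exp_abs[of r x] heat_exp'_abs[of r x] r by auto
  have S0: "0 \<le> S x" for x unfolding S_def by (intro sum_nonneg) auto
  \<comment> \<open>The reverse inequality itself bounds the squared gradient, because its
    right-hand side is bounded. This yields the integrability of \<open>grad_sq d f\<close> that
    \<open>LSI\<close> asks for.\<close>
  have SL: "S x \<le> 4 * (r * L) / h" for x
  proof -
    have "r * K' x \<le> r * L" using KL(2)[of x] r by (intro mult_left_mono) auto
    then have "h / 2 * S x \<le> 2 * (r * L)" using SK[of x] KL(1)[of x] by linarith
    then show ?thesis using h_pos by (simp add: field_simps)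
  qed
  define M where "M = exp (\<bar>b r\<bar> * (\<bar>r\<bar> * L))"
  have GM: "\<bar>G x\<bar> \<le> M" for x unfolding G_def K_def M_def using exp_powr_bound by simp
  have iG: "integrable \<pi> G" by (rule integrable_bounded_\<pi>[OF _ GM]) auto
  have M0: "0 \<le> M" unfolding M_def by simp
  have iGK: "integrable \<pi> (\<lambda>x. G x * K x)"
    by (rule integrable_bounded_\<pi>[where B="M * (r * L)"]) (auto simp: abs_mult M0 intro!: mult_mono GM KL)
  have iGK': "integrable \<pi> (\<lambda>x. G x * K' x)"
    by (rule integrable_bounded_\<pi>[where B="M * L"]) (auto simp: abs_mult M0 intro!: mult_mono GM KL)
  have iGS: "integrable \<pi> (\<lambda>x. G x * S x)"
  proof (rule integrable_bounded_\<pi>)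
    show "\<bar>G x * S x\<bar> \<le> M * (4 * (r * L) / h)" for x
      unfolding abs_mult abs_of_nonneg[OF S0] by (intro mult_mono GM SL S0 M0)
  qed auto
  have igrad: "integrable \<pi> (grad_sq d f)"
    using iGS unfolding grad[abs_def] by simp
  have "locally_Lipschitz d f" unfolding f_def[abs_def] by (rule locally_Lipschitz_heat_exp_powr)
  moreover have "integrable \<pi> (\<lambda>x. (f x)\<^sup>2)" unfolding f2 by (rule iG)
  ultimately have "(\<integral>x. (f x)\<^sup>2 * ln ((f x)\<^sup>2) \<partial>\<pi>) - (\<integral>x. (f x)\<^sup>2 \<partial>\<pi>) * ln (\<integral>x. (f x)\<^sup>2 \<partial>\<pi>)
          \<le> 2 * C * (\<integral>x. grad_sq d f x \<partial>\<pi>)"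
    using LSI igrad unfolding LSI_def by blast
  moreover have "(\<integral>x. G x \<partial>\<pi>) = \<Lambda> r" unfolding \<Lambda>_def G_def K_def ..
  moreover have "(\<integral>x. G x * (b r * K x) \<partial>\<pi>) = b r * (\<integral>x. G x * K x \<partial>\<pi>)"
    unfolding mult.left_commute[of "G _" "b r"] by simp
  ultimately have "b r * (\<integral>x. G x * K x \<partial>\<pi>) - \<Lambda> r * ln (\<Lambda> r) \<le> 2 * C * ((b r)\<^sup>2 / 4 * (\<integral>x. G x * S x \<partial>\<pi>))"
    unfolding lnf2 unfolding f2 grad by simp
  then have "\<eta> * (b r * (\<integral>x. G x * K x \<partial>\<pi>) - \<Lambda> r * ln (\<Lambda> r)) \<le> \<eta> * (2 * C * ((b r)\<^sup>2 / 4 * (\<integral>x. G x * S x \<partial>\<pi>)))"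
    using \<eta>_pos by (intro mult_left_mono) auto
  then have lsi: "\<eta> * b r * (\<integral>x. G x * K x \<partial>\<pi>) - \<eta> * (\<Lambda> r * ln (\<Lambda> r)) \<le> (b r)\<^sup>2 * (h / 2 * (\<integral>x. G x * S x \<partial>\<pi>))"
    unfolding \<eta>_def using C_pos by (simp add: field_simps)
  have "(\<integral>x. h / 2 * (G x * S x) \<partial>\<pi>) \<le> (\<integral>x. r * (G x * K' x) - G x * K x \<partial>\<pi>)"
  proof (rule integral_mono)
    fix x
    have "G x * (h / 2 * S x) \<le> G x * (r * K' x - K x)" using SK by (intro mult_left_mono) (auto simp: G_def)
    then show "h / 2 * (G x * S x) \<le> r * (G x * K' x) - G x * K x" by (simp add: algebra_simps)
  qed (use iGS iGK iGK' in auto)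
  then have "h / 2 * (\<integral>x. G x * S x \<partial>\<pi>) \<le> r * (\<integral>x. G x * K' x \<partial>\<pi>) - (\<integral>x. G x * K x \<partial>\<pi>)"
    using iGK iGK' by simp
  then have rev: "(b r)\<^sup>2 * (h / 2 * (\<integral>x. G x * S x \<partial>\<pi>)) \<le> (b r)\<^sup>2 * (r * (\<integral>x. G x * K' x \<partial>\<pi>) - (\<integral>x. G x * K x \<partial>\<pi>))"
    by (intro mult_left_mono) auto
  have "\<Lambda>' r = (\<integral>x. b' r * (G x * K x) + b r * (G x * K' x) \<partial>\<pi>)"
    unfolding \<Lambda>'_def G_def K_def K'_def by (intro Bochner_Integration.integral_cong) (auto simp: algebra_simps)
  also have "\<dots> = b' r * (\<integral>x. G x * K x \<partial>\<pi>) + b r * (\<integral>x. G x * K' x \<partial>\<pi>)"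
    using iGK iGK' by simp
  finally have \<Lambda>': "\<Lambda>' r = b' r * (\<integral>x. G x * K x \<partial>\<pi>) + b r * (\<integral>x. G x * K' x \<partial>\<pi>)" .
  \<comment> \<open>This says that \<open>r * b r\<close> has slope \<open>- \<eta>\<close>. It lets
    the \<open>K\<close> and \<open>K'\<close> terms combine into \<open>r * K' x - K x\<close>,
    which the reverse inequality controls, and leaves \<open>\<eta>\<close> times the entropy term,
    which \<open>lsi\<close> controls.\<close>
  have rb': "r * b' r = - (b r + \<eta>)" unfolding b'_def b_def using r by (simp add: power2_eq_square field_simps)
  have "r * b r * \<Lambda>' r = b r * (r * b' r) * (\<integral>x. G x * K x \<partial>\<pi>) + (b r)\<^sup>2 * (r * (\<integral>x. G x * K' x \<partial>\<pi>))"
    unfolding \<Lambda>' by (simp add: algebra_simps power2_eq_square)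
  also have "\<dots> = (b r)\<^sup>2 * (r * (\<integral>x. G x * K' x \<partial>\<pi>) - (\<integral>x. G x * K x \<partial>\<pi>)) - \<eta> * b r * (\<integral>x. G x * K x \<partial>\<pi>)"
    unfolding rb' by (simp add: algebra_simps power2_eq_square)
  finally show ?thesis using lsi rev by linarith
qed

text \<open>The two ends of the monotone quantity: at \<open>r = 1\<close> the exponent is
  \<open>p + (p - 1) * h / C\<close> and the function is the average of \<open>exp \<phi>\<close>;
  at \<open>r = p\<close> the exponent is \<open>p\<close> and \<open>b p = 1\<close>, so that
  \<open>\<Lambda> p\<close> is the integral of \<open>heat_exp p\<close> itself. In between
  \<open>a\<close> is at least \<open>p\<close>, so dividing by it is harmless.\<close>

lemma heat_exp_hypercontractive:
  "ln (\<integral>x. heat_exp 1 x powr (p + (p - 1) * h / C) \<partial>\<pi>) / (p + (p - 1) * h / C) \<le> ln (\<integral>x. heat_exp p x \<partial>\<pi>) / p"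
proof -
  define a where "a r = p * (1 + \<eta>) - \<eta> * r" for r
  have ab: "a r = r * b r" if "r \<ge> 1" for r unfolding a_def b_def using that by (simp add: field_simps)
  have a: "a r > 0" if "r \<le> p" for r
  proof -
    have "\<eta> * r \<le> \<eta> * p" using that \<eta>_pos by (intro mult_left_mono) auto
    then show ?thesis unfolding a_def using p by (simp add: algebra_simps)
  qed
  have "ln (\<Lambda> 1) / a 1 \<le> ln (\<Lambda> p) / a p"
  proof (rule DERIV_nonneg_imp_nondecreasing[OF p])
    fix r assume r: "1 \<le> r" "r \<le> p"
    have "(a has_real_derivative - \<eta>) (at r)" unfolding a_def[abs_def] by (auto intro!: derivative_eq_intros)
    moreover have "((\<lambda>r. ln (\<Lambda> r)) has_real_derivative \<Lambda>' r / \<Lambda> r) (at r)"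
      using \<Lambda>_pos[of r] \<Lambda>_deriv[OF r(1)] by (auto intro!: derivative_eq_intros)
    ultimately have "((\<lambda>r. ln (\<Lambda> r) / a r) has_real_derivative
        (\<Lambda>' r / \<Lambda> r * a r - ln (\<Lambda> r) * - \<eta>) / (a r * a r)) (at r)"
      using a[OF r(2)] by (intro DERIV_divide) auto
    moreover have "0 \<le> (\<Lambda>' r / \<Lambda> r * a r - ln (\<Lambda> r) * - \<eta>) / (a r * a r)"
    proof (rule divide_nonneg_nonneg)
      have "0 \<le> (a r * \<Lambda>' r + \<eta> * (\<Lambda> r * ln (\<Lambda> r))) / \<Lambda> r"
        using entropy_production[OF r(1)] \<Lambda>_pos[of r] by (simp add: ab[OF r(1)])
      then show "0 \<le> \<Lambda>' r / \<Lambda> r * a r - ln (\<Lambda> r) * - \<eta>"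
        using \<Lambda>_pos[of r] by (simp add: field_simps)
    qed simp
    ultimately show "\<exists>y. ((\<lambda>r. ln (\<Lambda> r) / a r) has_real_derivative y) (at r) \<and> 0 \<le> y" by blast
  qed
  moreover have "a 1 = p + (p - 1) * h / C" unfolding a_def \<eta>_def by (simp add: algebra_simps diff_divide_distrib)
  moreover have "a p = p" unfolding a_def by (simp add: algebra_simps)
  moreover have "\<Lambda> 1 = (\<integral>x. heat_exp 1 x powr a 1 \<partial>\<pi>)"
    unfolding \<Lambda>_def powr_def using heat_exp_pos[of 1] ab[of 1] by (simp add: less_imp_neq[THEN not_sym])
  moreover have "\<Lambda> p = (\<integral>x. heat_exp p x \<partial>\<pi>)"
  proof -
    have "b p = 1" using p by (simp add: b_def field_simps)
    then show ?thesis unfolding \<Lambda>_def using heat_exp_pos by simp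
  qed
  ultimately show ?thesis by simp
qed

end

end

end

section \<open>Jensen's inequality for powers, and densities pushed through kernels\<close>

lemma (in prob_space) nn_integral_le_powr:
  fixes X :: "'a \<Rightarrow> real"
  assumes [measurable]: "X \<in> borel_measurable M"
    and X: "\<And>x. x \<in> space M \<Longrightarrow> 0 \<le> X x" and s: "1 \<le> s" and c: "0 \<le> c"
    and le: "(\<integral>\<^sup>+x. ennreal (X x powr s) \<partial>M) \<le> ennreal c"
  shows "(\<integral>\<^sup>+x. ennreal (X x) \<partial>M) \<le> ennreal (c powr (1 / s))"
proof (cases "s = 1")
  case True
  then show ?thesis using le c X by (simp cong: nn_integral_cong)
next
  case False
  with s have s1: "s > 1" by simp
  have iXs: "integrable M (\<lambda>x. X x powr s)"
    using le by (intro integrableI_nonneg) (auto intro: le_less_trans)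
  have Xs: "(\<integral>x. X x powr s \<partial>M) \<le> c"
  proof -
    have "ennreal (\<integral>x. X x powr s \<partial>M) \<le> ennreal c"
      using le by (subst nn_integral_eq_integral[symmetric]) (auto simp: iXs)
    then show ?thesis using c by (simp add: ennreal_le_iff)
  qed
  have iX: "integrable M X"
  proof (rule Bochner_Integration.integrable_bound[where f="\<lambda>x. 1 + X x powr s"])
    show "AE x in M. norm (X x) \<le> norm (1 + X x powr s)"
    proof (rule AE_I2)
      fix x assume "x \<in> space M"
      then have "0 \<le> X x" by (rule X)
      moreover have "X x \<le> 1 + X x powr s"
      proof (cases "X x \<le> 1")
        case True then show ?thesis by (simp add: add_increasing2)
      next
        case False
        then have "X x powr 1 \<le> X x powr s" using s by (intro powr_mono) auto
        then show ?thesis using False by simp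
      qed
      ultimately show "norm (X x) \<le> norm (1 + X x powr s)" by simp
    qed
  qed (use iXs in auto)
  define m where "m = (\<integral>x. X x \<partial>M)"
  have m0: "0 \<le> m" unfolding m_def using X by (intro integral_nonneg_AE) auto
  \<comment> \<open>Young's inequality with the mean \<open>m\<close> in the second factor is the
    tangent line at \<open>m\<close> of the function \<open>t powr s / s\<close>; integrating it
    gives Jensen's inequality.\<close>
  have "(\<integral>x. X x * m powr (s - 1) \<partial>M) \<le> (\<integral>x. X x powr s / s + m powr s * (1 - 1 / s) \<partial>M)"
  proof (rule integral_mono)
    fix x assume "x \<in> space M"
    then have "X x * m powr (s - 1) \<le> X x powr s / s + (m powr (s - 1)) powr (s / (s - 1)) / (s / (s - 1))"
      using s1 X by (intro Youngs_inequality) (auto simp: field_simps)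
    then show "X x * m powr (s - 1) \<le> X x powr s / s + m powr s * (1 - 1 / s)"
    proof -
      have "(m powr (s - 1)) powr (s / (s - 1)) = m powr s" using s1 by (simp add: powr_powr)
      moreover have "m powr s / (s / (s - 1)) = m powr s * (1 - 1 / s)" using s1 by (simp add: field_simps)
      ultimately show ?thesis using \<open>X x * m powr (s - 1) \<le> _\<close> by simp
    qed
  qed (use iX iXs in auto)
  then have "m * m powr (s - 1) \<le> (\<integral>x. X x powr s \<partial>M) / s + m powr s * (1 - 1 / s)"
    using iX iXs prob_space by (simp add: m_def)
  moreover have "m * m powr (s - 1) = m powr s"
    using m0 by (cases "m = 0") (auto simp: powr_mult_base)
  ultimately have "m powr s / s \<le> (\<integral>x. X x powr s \<partial>M) / s" by (simp add: algebra_simps)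
  then have "m powr s \<le> c" using s1 Xs by (simp add: divide_le_cancel)
  then have "(m powr s) powr (1 / s) \<le> c powr (1 / s)" using s1 by (intro powr_mono2) auto
  then have "m \<le> c powr (1 / s)" using s1 m0 by (simp add: powr_powr)
  moreover have "(\<integral>\<^sup>+x. ennreal (X x) \<partial>M) = ennreal m"
    unfolding m_def using X by (intro nn_integral_eq_integral iX) auto
  ultimately show ?thesis using ennreal_leI by simp
qed

text \<open>Tonelli's theorem for a Markov kernel with densities. The two base measures are separate
  because the forward half-step goes from \<open>\<pi>\<close> to Lebesgue measure and the backward
  one returns to \<open>\<pi>\<close>.\<close>

lemma bind_density:
  fixes k :: "'a \<Rightarrow> 'b \<Rightarrow> ennreal" and f :: "'a \<Rightarrow> ennreal"
  assumes "sigma_finite_measure M" "sigma_finite_measure N"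
    and f [measurable]: "f \<in> borel_measurable M" and pf: "prob_space (density M f)"
    and k [measurable]: "(\<lambda>p. k (fst p) (snd p)) \<in> borel_measurable (M \<Otimes>\<^sub>M N)"
    and k1: "\<And>x. x \<in> space M \<Longrightarrow> (\<integral>\<^sup>+y. k x y \<partial>N) = 1"
  shows "density M f \<bind> (\<lambda>x. density N (k x)) = density N (\<lambda>y. \<integral>\<^sup>+x. f x * k x y \<partial>M)" (is "?L = ?R")
    and "prob_space (density N (\<lambda>y. \<integral>\<^sup>+x. f x * k x y \<partial>M))"
    and "(\<lambda>y. \<integral>\<^sup>+x. f x * k x y \<partial>M) \<in> borel_measurable N"
proof -
  interpret M: sigma_finite_measure M by fact
  interpret N: sigma_finite_measure N by fact
  interpret pair_sigma_finite M N ..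
  interpret f: prob_space "density M f" by fact
  have ne: "space (density M f) \<noteq> {}" by (rule f.not_empty)
  have kx [measurable]: "k x \<in> borel_measurable N" if "x \<in> space M" for x
    using measurable_compose_Pair1[OF that k] by simp
  have fk: "(\<lambda>(x, y). f x * k x y) \<in> borel_measurable (M \<Otimes>\<^sub>M N)"
    unfolding case_prod_beta' by measurable
  have m: "(\<lambda>(y, x). f x * k x y) \<in> borel_measurable (N \<Otimes>\<^sub>M M)"
    using measurable_pair_swap[OF fk] by (simp add: case_prod_beta')
  then show r [measurable]: "(\<lambda>y. \<integral>\<^sup>+x. f x * k x y \<partial>M) \<in> borel_measurable N"
    by (rule M.borel_measurable_nn_integral)
  have swap: "(\<integral>\<^sup>+x. f x * (\<integral>\<^sup>+y. k x y * indicator A y \<partial>N) \<partial>M) = (\<integral>\<^sup>+y. (\<integral>\<^sup>+x. f x * k x y \<partial>M) * indicator A y \<partial>N)"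
    if [measurable]: "A \<in> sets N" for A
  proof -
    have "(\<integral>\<^sup>+y. (\<integral>\<^sup>+x. f x * k x y \<partial>M) * indicator A y \<partial>N) = (\<integral>\<^sup>+y. \<integral>\<^sup>+x. f x * k x y * indicator A y \<partial>M \<partial>N)"
    proof (intro nn_integral_cong nn_integral_multc[symmetric])
      fix y assume y: "y \<in> space N"
      show "(\<lambda>x. f x * k x y) \<in> borel_measurable M"
        using measurable_compose_Pair1[OF y m] by simp
    qed
    also have "\<dots> = (\<integral>\<^sup>+x. \<integral>\<^sup>+y. f x * k x y * indicator A y \<partial>N \<partial>M)"
      by (rule Fubini') (simp add: case_prod_beta')
    also have "\<dots> = (\<integral>\<^sup>+x. f x * (\<integral>\<^sup>+y. k x y * indicator A y \<partial>N) \<partial>M)"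
      by (intro nn_integral_cong) (simp add: nn_integral_cmult mult.assoc)
    finally show ?thesis ..
  qed
  have K: "(\<lambda>x. density N (k x)) \<in> measurable (density M f) (subprob_algebra N)"
  proof (rule measurable_subprob_algebra)
    show "subprob_space (density N (k x))" if "x \<in> space (density M f)" for x
      using that k1[of x] by (intro prob_space_imp_subprob_space prob_spaceI) (simp add: emeasure_density cong: nn_integral_cong)
    fix A assume [measurable]: "A \<in> sets N"
    have "(\<lambda>x. \<integral>\<^sup>+y. k x y * indicator A y \<partial>N) \<in> borel_measurable M"
      by (rule N.borel_measurable_nn_integral) (simp add: case_prod_beta')
    then have "(\<lambda>x. emeasure (density N (k x)) A) \<in> borel_measurable M"
      by (subst measurable_cong[where g="\<lambda>x. \<integral>\<^sup>+y. k x y * indicator A y \<partial>N"]) (auto simp: emeasure_density)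
    then show "(\<lambda>x. emeasure (density N (k x)) A) \<in> borel_measurable (density M f)" by simp
  qed simp
  show eq: "?L = ?R"
  proof (rule measure_eqI)
    show "sets ?L = sets ?R" using ne by (subst sets_bind[where N=N]) auto
    fix A assume "A \<in> sets ?L"
    then have A [measurable]: "A \<in> sets N" using ne by (subst (asm) sets_bind[where N=N]) auto
    have Am: "(\<lambda>x. \<integral>\<^sup>+y. k x y * indicator A y \<partial>N) \<in> borel_measurable M"
      by (rule N.borel_measurable_nn_integral) (simp add: case_prod_beta')
    have "emeasure ?L A = (\<integral>\<^sup>+x. emeasure (density N (k x)) A \<partial>density M f)"
      by (rule emeasure_bind[OF ne K A])
    also have "\<dots> = (\<integral>\<^sup>+x. (\<integral>\<^sup>+y. k x y * indicator A y \<partial>N) \<partial>density M f)"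
      by (intro nn_integral_cong) (simp add: emeasure_density)
    also have "\<dots> = (\<integral>\<^sup>+x. f x * (\<integral>\<^sup>+y. k x y * indicator A y \<partial>N) \<partial>M)"
      by (rule nn_integral_density[OF f Am])
    also have "\<dots> = emeasure ?R A"
      by (simp add: swap[OF A] emeasure_density)
    finally show "emeasure ?L A = emeasure ?R A" .
  qed
  have "prob_space ?L"
  proof (rule f.prob_space_bind[OF _ K])
    show "AE x in density M f. prob_space (density N (k x))"
      using k1 by (intro AE_I2 prob_spaceI) (simp add: emeasure_density cong: nn_integral_cong)
  qed
  then show "prob_space ?R" unfolding eq .
qed

section \<open>From bounded logarithms to arbitrary nonnegative functions\<close>

context gaussian_kernel
begin

lemma heat_hypercontractive:
  fixes g :: "(nat \<Rightarrow> real) \<Rightarrow> real"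
  assumes \<pi>: "prob_space \<pi>" "sets \<pi> = sets (Rd d)" "LSI d \<pi> C" "C > 0"
    and g [measurable]: "g \<in> borel_measurable (Rd d)" and g0: "\<And>z. 0 \<le> g z"
    and p: "1 \<le> p" and c: "0 \<le> c"
    and le: "(\<integral>\<^sup>+x. \<integral>\<^sup>+z. ennreal (g z powr p) \<partial>\<gamma> x \<partial>\<pi>) \<le> ennreal c"
  shows "(\<integral>\<^sup>+x. ennreal (enn2real (\<integral>\<^sup>+z. ennreal (g z) \<partial>\<gamma> x) powr (p + (p - 1) * h / C)) \<partial>\<pi>)
           \<le> ennreal (c powr ((p + (p - 1) * h / C) / p))"
proof -
  interpret \<pi>: prob_space \<pi> by fact
  have meas: "measurable \<pi> N = measurable (Rd d) N" for N
    by (intro measurable_cong_sets \<pi>(2) refl)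
  define q where "q = p + (p - 1) * h / C"
  have q: "q > 0" unfolding q_def using p h_pos \<pi>(4) by (intro add_pos_nonneg) auto
  \<comment> \<open>Clamping \<open>g\<close> from both sides makes \<open>ln (G n z)\<close>
    bounded, as the preceding theory requires, while \<open>G n\<close> still converges pointwise to
    \<open>g\<close>.\<close>
  define G where "G n z = max (1 / real (Suc n)) (min (real (Suc n)) (g z))" for n z
  have [measurable]: "G n \<in> borel_measurable (Rd d)" for n unfolding G_def by measurable
  have Gpos: "G n z > 0" for n z unfolding G_def by (simp add: less_max_iff_disj)
  have G_bounds: "1 / real (Suc n) \<le> G n z" "G n z \<le> real (Suc n)" for n z
  proof -
    have "1 / real (Suc n) \<le> 1" "1 \<le> real (Suc n)" by auto
    then show "1 / real (Suc n) \<le> G n z" "G n z \<le> real (Suc n)" unfolding G_def by linarith+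
  qed
  have Gg: "G n z \<le> g z + 1" for n z 
  proof -
    have "1 / real (Suc n) \<le> 1" by auto
    then show ?thesis unfolding G_def using g0[of z] by linarith
  qed
  define L where "L n = ln (real (Suc n))" for n
  have \<phi>_meas: "(\<lambda>z. ln (G n z)) \<in> borel_measurable (Rd d)" for n by measurable
  have \<phi>_bd: "\<bar>ln (G n z)\<bar> \<le> L n" for n z
  proof -
    have "ln (1 / real (Suc n)) \<le> ln (G n z)" using G_bounds Gpos by (intro ln_mono) auto
    moreover have "ln (G n z) \<le> ln (real (Suc n))" using G_bounds Gpos by (intro ln_mono) auto
    ultimately show ?thesis by (simp add: L_def ln_div)
  qed
  define P where "P n x = (\<integral>z. G n z \<partial>\<gamma> x)" for n x
  define Pp where "Pp n x = (\<integral>z. G n z powr p \<partial>\<gamma> x)" for n x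
  have [measurable]: "P n \<in> borel_measurable (Rd d)" "Pp n \<in> borel_measurable (Rd d)" for n
    unfolding P_def[abs_def] Pp_def[abs_def] by measurable
  have exp1: "exp (1 * ln (G n z)) = G n z" for n z using Gpos by simp
  have expp: "exp (p * ln (G n z)) = G n z powr p" for n z using Gpos[of n z] by (simp add: powr_def)
  have P_bd: "1 / real (Suc n) \<le> P n x" "P n x \<le> real (Suc n)" for n x
    unfolding P_def using G_bounds by (auto intro!: heat_bounds)
  have Gp_bd: "(1 / real (Suc n)) powr p \<le> G n z powr p" "G n z powr p \<le> real (Suc n) powr p" for n z
    using G_bounds[of n z] Gpos[of n z] p by (auto intro!: powr_mono2)
  have Pp_bd: "(1 / real (Suc n)) powr p \<le> Pp n x" "Pp n x \<le> real (Suc n) powr p" for n x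
    unfolding Pp_def using Gp_bd by (auto intro!: heat_bounds)
  have Ppos: "0 < P n x" "0 < Pp n x" for n x
    using P_bd(1)[of n x] Pp_bd(1)[of n x] by (auto intro: less_le_trans[rotated])
  have iP: "integrable \<pi> (\<lambda>x. P n x powr q)" for n
  proof (rule \<pi>.integrable_const_bound[where B="real (Suc n) powr q"])
    have "P n x powr q \<le> real (Suc n) powr q" for x
      using P_bd(2)[of n x] Ppos(1)[of n x] q by (intro powr_mono2) auto
    then show "AE x in \<pi>. norm (P n x powr q) \<le> real (Suc n) powr q" by (intro AE_I2) simp
  qed (simp add: meas)
  have iPp: "integrable \<pi> (Pp n)" for n
    using Pp_bd[of n] Ppos(2)[of n]
    by (intro \<pi>.integrable_const_bound[where B="real (Suc n) powr p"]) (auto simp: meas intro!: AE_I2 simp: less_imp_le)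
  have step: "(\<integral>\<^sup>+x. ennreal (P n x powr q) \<partial>\<pi>) \<le> ennreal ((c + 1 / real (Suc n)) powr (q / p))" for n
  proof -
    have h: "ln (\<integral>x. P n x powr q \<partial>\<pi>) / q \<le> ln (\<integral>x. Pp n x \<partial>\<pi>) / p"
      using heat_exp_hypercontractive[OF \<phi>_meas[of n] \<phi>_bd[of n] \<pi> p]
      unfolding heat_exp_def[OF \<phi>_meas[of n] \<phi>_bd[of n]] exp1 expp q_def P_def Pp_def .
    have pos1: "0 < (\<integral>x. P n x powr q \<partial>\<pi>)"
    proof -
      have "(1 / real (Suc n)) powr q \<le> (\<integral>x. P n x powr q \<partial>\<pi>)"
        using P_bd(1)[of n] q by (intro \<pi>.integral_ge_const iP AE_I2 powr_mono2) auto
      then show ?thesis by (rule less_le_trans[rotated]) simp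
    qed
    have pos2: "0 < (\<integral>x. Pp n x \<partial>\<pi>)"
    proof -
      have "(1 / real (Suc n)) powr p \<le> (\<integral>x. Pp n x \<partial>\<pi>)"
        using Pp_bd(1)[of n] by (intro \<pi>.integral_ge_const iPp AE_I2) auto
      then show ?thesis by (rule less_le_trans[rotated]) simp
    qed
    have "ennreal (\<integral>x. Pp n x \<partial>\<pi>) = (\<integral>\<^sup>+x. ennreal (Pp n x) \<partial>\<pi>)"
      using Ppos(2)[of n] by (intro nn_integral_eq_integral[symmetric] iPp) (auto intro: less_imp_le)
    also have "\<dots> = (\<integral>\<^sup>+x. \<integral>\<^sup>+z. ennreal (G n z powr p) \<partial>\<gamma> x \<partial>\<pi>)"
      unfolding Pp_def
      by (intro nn_integral_cong nn_integral_eq_integral[symmetric] integrable_bounded_\<gamma>[where B="real (Suc n) powr p"])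
         (use Gp_bd in auto)
    also have "\<dots> \<le> (\<integral>\<^sup>+x. \<integral>\<^sup>+z. ennreal (g z powr p) + ennreal (1 / real (Suc n)) \<partial>\<gamma> x \<partial>\<pi>)"
    proof (intro nn_integral_mono)
      fix z
      \<comment> \<open>Clamping from above only lowers the power. Clamping from below adds at most
        the \<open>p\<close>-th power of a number in the unit interval, which for
        \<open>p \<ge> 1\<close> is at most that number.\<close>
      have "G n z powr p \<le> g z powr p + 1 / real (Suc n)"
      proof (cases "1 / real (Suc n) \<le> g z")
        case True
        then have "G n z \<le> g z" unfolding G_def by auto
        then have "G n z powr p \<le> g z powr p" using Gpos[of n z] p by (intro powr_mono2) auto
        then show ?thesis by (simp add: add_increasing2)
      next
        case False
        then have "G n z = 1 / real (Suc n)" unfolding G_def by linarith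
        moreover have "(1 / real (Suc n)) powr p \<le> (1 / real (Suc n)) powr 1" using p by (intro powr_mono') auto
        ultimately show ?thesis by (simp add: add_increasing)
      qed
      then show "ennreal (G n z powr p) \<le> ennreal (g z powr p) + ennreal (1 / real (Suc n))"
        by (simp add: ennreal_plus[symmetric] ennreal_leI del: ennreal_plus)
    qed
    also have "\<dots> = (\<integral>\<^sup>+x. (\<integral>\<^sup>+z. ennreal (g z powr p) \<partial>\<gamma> x) + ennreal (1 / real (Suc n)) \<partial>\<pi>)"
      using prob_space.emeasure_space_1[OF prob_space_\<gamma>]
      by (intro nn_integral_cong) (subst nn_integral_add, auto)
    also have "\<dots> = (\<integral>\<^sup>+x. (\<integral>\<^sup>+z. ennreal (g z powr p) \<partial>\<gamma> x) \<partial>\<pi>) + ennreal (1 / real (Suc n))"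
    proof -
      have "(\<lambda>(x, z). ennreal (kern x z) * ennreal (g z powr p)) \<in> borel_measurable (Rd d \<Otimes>\<^sub>M Rd d)"
        unfolding case_prod_beta' by measurable
      from Rd.borel_measurable_nn_integral[OF this]
      have "(\<lambda>x. \<integral>\<^sup>+z. ennreal (g z powr p) \<partial>\<gamma> x) \<in> borel_measurable \<pi>"
        unfolding meas by (subst nn_integral_\<gamma>) auto
      then show ?thesis using \<pi>.emeasure_space_1 by (subst nn_integral_add) auto
    qed
    also have "\<dots> \<le> ennreal c + ennreal (1 / real (Suc n))" by (intro add_right_mono le)
    also have "\<dots> = ennreal (c + 1 / real (Suc n))" using c by simp
    finally have "(\<integral>x. Pp n x \<partial>\<pi>) \<le> c + 1 / real (Suc n)" using c by (subst (asm) ennreal_le_iff) auto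
    then have "ln (\<integral>x. Pp n x \<partial>\<pi>) \<le> ln (c + 1 / real (Suc n))" using pos2 by (intro ln_mono) auto
    then have "ln (\<integral>x. Pp n x \<partial>\<pi>) / p \<le> ln (c + 1 / real (Suc n)) / p" using p by (intro divide_right_mono) auto
    with h have "ln (\<integral>x. P n x powr q \<partial>\<pi>) / q \<le> ln (c + 1 / real (Suc n)) / p" by linarith
    then have "ln (\<integral>x. P n x powr q \<partial>\<pi>) \<le> q / p * ln (c + 1 / real (Suc n))" using q by (simp add: field_simps)
    then have "exp (ln (\<integral>x. P n x powr q \<partial>\<pi>)) \<le> exp (q / p * ln (c + 1 / real (Suc n)))" by simp
    moreover have "c + 1 / real (Suc n) > 0" using c by (intro add_nonneg_pos) auto
    ultimately have "(\<integral>x. P n x powr q \<partial>\<pi>) \<le> (c + 1 / real (Suc n)) powr (q / p)"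
      unfolding powr_def[of "c + 1 / real (Suc n)"] exp_ln[OF pos1] by simp
    then show ?thesis
      by (subst nn_integral_eq_integral[OF iP]) (auto intro: ennreal_leI)
  qed
  \<comment> \<open>Where the average of \<open>g\<close> is infinite, \<open>enn2real\<close>
    returns 0 and there is nothing to show; elsewhere dominated convergence with
    \<open>g z + 1\<close> gives an actual limit.\<close>
  have lim: "ennreal (enn2real (\<integral>\<^sup>+z. ennreal (g z) \<partial>\<gamma> x) powr q) \<le> liminf (\<lambda>n. ennreal (P n x powr q))" for x
  proof (cases "(\<integral>\<^sup>+z. ennreal (g z) \<partial>\<gamma> x) = \<infinity>")
    case True
    then show ?thesis using q by simp
  next
    case False
    interpret \<gamma>: prob_space "\<gamma> x" by (rule prob_space_\<gamma>)
    have ig: "integrable (\<gamma> x) g"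
      using False g0 by (intro integrableI_nonneg) (auto simp: top.not_eq_extremum)
    have "(\<lambda>n. P n x) \<longlonglongrightarrow> (\<integral>z. g z \<partial>\<gamma> x)"
      unfolding P_def
    proof (rule integral_dominated_convergence[where w="\<lambda>z. g z + 1"])
      show "AE z in \<gamma> x. (\<lambda>n. G n z) \<longlonglongrightarrow> g z"
      proof (rule AE_I2)
        fix z
        obtain m where m: "g z \<le> real m" using real_arch_simple by blast
        have "(\<lambda>n. max (1 / real (Suc n)) (g z)) \<longlonglongrightarrow> max 0 (g z)"
          using LIMSEQ_inverse_real_of_nat by (intro tendsto_max) (auto simp: inverse_eq_divide)
        moreover have "\<forall>\<^sub>F n in sequentially. max (1 / real (Suc n)) (g z) = G n z"
          using eventually_ge_at_top[of m]
        proof eventually_elim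
          case (elim n)
          then have "g z \<le> real (Suc n)" using m by linarith
          then show ?case unfolding G_def by simp
        qed
        ultimately have "(\<lambda>n. G n z) \<longlonglongrightarrow> max 0 (g z)" by (rule Lim_transform_eventually)
        then show "(\<lambda>n. G n z) \<longlonglongrightarrow> g z" using g0[of z] by simp
      qed
      show "AE z in \<gamma> x. norm (G n z) \<le> g z + 1" for n
        using Gg Gpos by (intro AE_I2) (auto simp: abs_of_pos)
    qed (use ig in auto)
    then have "(\<lambda>n. P n x powr q) \<longlonglongrightarrow> (\<integral>z. g z \<partial>\<gamma> x) powr q"
      using q Ppos by (intro tendsto_powr') (auto intro!: always_eventually less_imp_le)
    then have "(\<lambda>n. ennreal (P n x powr q)) \<longlonglongrightarrow> ennreal ((\<integral>z. g z \<partial>\<gamma> x) powr q)" by (rule tendsto_ennrealI)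
    then have "liminf (\<lambda>n. ennreal (P n x powr q)) = ennreal ((\<integral>z. g z \<partial>\<gamma> x) powr q)"
      by (intro lim_imp_Liminf) auto
    moreover have "(\<integral>\<^sup>+z. ennreal (g z) \<partial>\<gamma> x) = ennreal (\<integral>z. g z \<partial>\<gamma> x)"
      using g0 by (intro nn_integral_eq_integral ig) auto
    ultimately show ?thesis using g0 by (simp add: integral_nonneg_AE)
  qed
  have "(\<integral>\<^sup>+x. ennreal (enn2real (\<integral>\<^sup>+z. ennreal (g z) \<partial>\<gamma> x) powr q) \<partial>\<pi>) \<le> (\<integral>\<^sup>+x. liminf (\<lambda>n. ennreal (P n x powr q)) \<partial>\<pi>)"
    by (intro nn_integral_mono lim)
  also have "\<dots> \<le> liminf (\<lambda>n. \<integral>\<^sup>+x. ennreal (P n x powr q) \<partial>\<pi>)"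
    by (rule nn_integral_liminf) (simp add: meas)
  also have "\<dots> \<le> liminf (\<lambda>n. ennreal ((c + 1 / real (Suc n)) powr (q / p)))"
    by (intro Liminf_mono always_eventually allI step)
  also have "\<dots> = ennreal (c powr (q / p))"
  proof (rule lim_imp_Liminf)
    have "(\<lambda>n. c + 1 / real (Suc n)) \<longlonglongrightarrow> c + 0"
      using LIMSEQ_inverse_real_of_nat by (intro tendsto_add) (auto simp: inverse_eq_divide)
    then have "(\<lambda>n. (c + 1 / real (Suc n)) powr (q / p)) \<longlonglongrightarrow> c powr (q / p)"
      using q p c by (intro tendsto_powr') auto
    then show "(\<lambda>n. ennreal ((c + 1 / real (Suc n)) powr (q / p))) \<longlonglongrightarrow> ennreal (c powr (q / p))"
      by (rule tendsto_ennrealI)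
  qed simp
  finally show ?thesis unfolding q_def .
qed

end

section \<open>One step of the proximal sampler\<close>

text \<open>Bounding \<open>\<integral> f\<^sup>p d\<pi>\<close> by \<open>exp((p - 1) R)\<close> rather than its logarithm avoids the junk value \<open>ln 0 = 0\<close>.\<close>

definition Renyi_le :: "real \<Rightarrow> 'a measure \<Rightarrow> 'a measure \<Rightarrow> real \<Rightarrow> bool" where
  "Renyi_le p \<mu> \<pi> R \<longleftrightarrow> prob_space \<mu> \<and>
     (\<exists>f\<in>borel_measurable \<pi>. (\<forall>x. 0 \<le> f x) \<and> \<mu> = density \<pi> (\<lambda>x. ennreal (f x)) \<and>
        (\<integral>\<^sup>+x. ennreal (f x powr p) \<partial>\<pi>) \<le> ennreal (exp ((p - 1) * R)))"

lemma Renyi_leE: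
  assumes "Renyi_le p \<mu> \<pi> R"
  obtains f where "prob_space \<mu>" "f \<in> borel_measurable \<pi>" "\<And>x. 0 \<le> f x" "\<mu> = density \<pi> (\<lambda>x. ennreal (f x))"
    "(\<integral>\<^sup>+x. ennreal (f x powr p) \<partial>\<pi>) \<le> ennreal (exp ((p - 1) * R))"
  using assms unfolding Renyi_le_def by blast

lemma Renyi_le_weaken:
  assumes "Renyi_le p \<mu> \<pi> R" "R \<le> R'" "1 \<le> p"
  shows "Renyi_le p \<mu> \<pi> R'"
proof -
  have "ennreal (exp ((p - 1) * R)) \<le> ennreal (exp ((p - 1) * R'))"
    using assms(2,3) by (intro ennreal_leI) (simp add: mult_left_mono)
  then show ?thesis using assms(1) unfolding Renyi_le_def by (blast intro: order_trans)
qed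

text \<open>A probability density has mean one, so Jensen's inequality forbids a \<open>p\<close>-th
  moment below one. This keeps the logarithms away from 0 and makes the divergence
  nonnegative.\<close>

lemma density_powr_bound_ge_one:
  assumes "prob_space \<pi>" "prob_space (density \<pi> (\<lambda>x. ennreal (f x)))" and [measurable]: "f \<in> borel_measurable \<pi>"
    and "\<And>x. 0 \<le> f x" "1 \<le> p" "0 \<le> c" "(\<integral>\<^sup>+x. ennreal (f x powr p) \<partial>\<pi>) \<le> ennreal c"
  shows "1 \<le> c"
proof -
  interpret \<pi>: prob_space \<pi> by fact
  interpret \<mu>: prob_space "density \<pi> (\<lambda>x. ennreal (f x))" by fact
  have "1 = (\<integral>\<^sup>+x. ennreal (f x) \<partial>\<pi>)"
    using \<mu>.emeasure_space_1 by (simp add: emeasure_density cong: nn_integral_cong)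
  also have "\<dots> \<le> ennreal (c powr (1 / p))"
    by (rule \<pi>.nn_integral_le_powr) (use assms in auto)
  finally have "1 \<le> c powr (1 / p)" by (simp flip: ennreal_1 add: ennreal_le_iff)
  then have "1 powr p \<le> (c powr (1 / p)) powr p" using assms by (intro powr_mono2) auto
  then show ?thesis using assms by (simp add: powr_powr)
qed

lemma Renyi_le_nonneg:
  assumes "Renyi_le p \<mu> \<pi> R" "prob_space \<pi>" "1 < p"
  shows "0 \<le> R"
proof -
  obtain f where \<mu>: "prob_space \<mu>" and f: "f \<in> borel_measurable \<pi>" "\<And>x. 0 \<le> f x"
    and dens: "\<mu> = density \<pi> (\<lambda>x. ennreal (f x))"
    and bound: "(\<integral>\<^sup>+x. ennreal (f x powr p) \<partial>\<pi>) \<le> ennreal (exp ((p - 1) * R))"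
    using assms(1) by (rule Renyi_leE) blast
  have "1 \<le> exp ((p - 1) * R)"
    by (rule density_powr_bound_ge_one[OF assms(2) \<mu>[unfolded dens] f _ _ bound]) (use assms(3) in auto)
  then show ?thesis using assms(3) by (simp add: zero_le_mult_iff)
qed

text \<open>Jensen's inequality under \<open>\<mu>\<close>, since \<open>\<integral> f\<^sup>p d\<pi> = \<integral> f\<^bsup>p - 1\<^esup> d\<mu>\<close>.\<close>

lemma Renyi_le_antimono_exponent:
  assumes le: "Renyi_le p \<mu> \<pi> R" and p': "1 < p'" "p' \<le> p"
  shows "Renyi_le p' \<mu> \<pi> R"
proof -
  obtain f where \<mu>: "prob_space \<mu>" and f [measurable]: "f \<in> borel_measurable \<pi>" and f0: "\<And>x. 0 \<le> f x"
    and dens: "\<mu> = density \<pi> (\<lambda>x. ennreal (f x))"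
    and bound: "(\<integral>\<^sup>+x. ennreal (f x powr p) \<partial>\<pi>) \<le> ennreal (exp ((p - 1) * R))"
    using le by (rule Renyi_leE) blast
  have tilt: "(\<integral>\<^sup>+x. ennreal (f x powr (s - 1)) \<partial>\<mu>) = (\<integral>\<^sup>+x. ennreal (f x powr s) \<partial>\<pi>)" if "s > 1" for s
  proof -
    have "ennreal (f x) * ennreal (f x powr (s - 1)) = ennreal (f x powr s)" for x
      using f0[of x] by (cases "f x = 0") (auto simp: ennreal_mult[symmetric] powr_mult_base)
    then show ?thesis unfolding dens by (subst nn_integral_density) auto
  qed
  have fm: "f \<in> borel_measurable \<mu>" using f unfolding dens by simp
  have "(\<integral>\<^sup>+x. ennreal (f x powr (p' - 1)) \<partial>\<mu>) \<le> ennreal (exp ((p - 1) * R) powr (1 / ((p - 1) / (p' - 1))))"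
  proof (rule prob_space.nn_integral_le_powr[OF \<mu>])
    have "(f x powr (p' - 1)) powr ((p - 1) / (p' - 1)) = f x powr (p - 1)" for x
      using p' by (simp add: powr_powr)
    then show "(\<integral>\<^sup>+x. ennreal ((f x powr (p' - 1)) powr ((p - 1) / (p' - 1))) \<partial>\<mu>) \<le> ennreal (exp ((p - 1) * R))"
      using bound tilt[of p] p' by simp
  qed (use p' fm in auto)
  also have "exp ((p - 1) * R) powr (1 / ((p - 1) / (p' - 1))) = exp ((p' - 1) * R)"
    using p' by (simp add: powr_def field_simps)
  finally show ?thesis unfolding Renyi_le_def using \<mu> f f0 dens tilt[of p'] p' by (intro conjI bexI[of _ f]) auto
qed

lemma Renyi_le_imp_Renyi:
  assumes le: "Renyi_le q \<mu> \<pi> R" and \<pi>: "prob_space \<pi>" and q: "1 < q"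
  shows "Renyi q \<mu> \<pi> \<le> ereal R"
proof -
  interpret \<pi>: prob_space \<pi> by fact
  obtain f where \<mu>: "prob_space \<mu>" and f [measurable]: "f \<in> borel_measurable \<pi>" and f0: "\<And>x. 0 \<le> f x"
    and dens: "\<mu> = density \<pi> (\<lambda>x. ennreal (f x))"
    and bound: "(\<integral>\<^sup>+x. ennreal (f x powr q) \<partial>\<pi>) \<le> ennreal (exp ((q - 1) * R))"
    using le by (rule Renyi_leE) blast
  have "AE x in \<pi>. ennreal (f x) = RN_deriv \<pi> \<mu> x"
    by (rule \<pi>.RN_deriv_unique) (auto simp: dens)
  then have ae: "AE x in \<pi>. enn2real (RN_deriv \<pi> \<mu> x) powr q = f x powr q"
    by eventually_elim (metis f0 enn2real_ennreal)
  have i: "integrable \<pi> (\<lambda>x. f x powr q)"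
    using bound by (intro integrableI_nonneg) (auto intro: le_less_trans)
  define J where "J = (\<integral>x. f x powr q \<partial>\<pi>)"
  have nJ: "(\<integral>\<^sup>+x. ennreal (f x powr q) \<partial>\<pi>) = ennreal J"
    unfolding J_def by (rule nn_integral_eq_integral[OF i]) auto
  have J0: "0 \<le> J" unfolding J_def by simp
  have J1: "1 \<le> J"
    by (rule density_powr_bound_ge_one[OF \<pi> \<mu>[unfolded dens] f f0 _ J0, of q]) (use q nJ in auto)
  have JR: "J \<le> exp ((q - 1) * R)" using bound unfolding nJ by (simp add: ennreal_le_iff)
  have "ln J \<le> ln (exp ((q - 1) * R))" using J1 JR by (intro ln_mono) auto
  then have R: "ln J / (q - 1) \<le> R" using q by (simp add: divide_le_eq mult.commute)
  have "absolutely_continuous \<pi> \<mu>" unfolding dens by (rule absolutely_continuousI_density) measurable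
  moreover have "integrable \<pi> (\<lambda>x. enn2real (RN_deriv \<pi> \<mu> x) powr q)"
    using i by (subst integrable_cong_AE[OF _ _ ae]) auto
  moreover have "(\<integral>x. enn2real (RN_deriv \<pi> \<mu> x) powr q \<partial>\<pi>) = J"
    unfolding J_def by (rule integral_cong_AE[OF _ _ ae]) auto
  ultimately have "Renyi q \<mu> \<pi> = ereal (q / (q - 1) * ln (J powr (1 / q)))" unfolding Renyi_def by simp
  also have "q / (q - 1) * ln (J powr (1 / q)) = ln J / (q - 1)" using J1 q by (simp add: ln_powr)
  finally show ?thesis using R by simp
qed

lemma Renyi_eq_imp_Renyi_le:
  assumes R: "Renyi p \<mu> \<pi> = ereal R" and \<pi>: "prob_space \<pi>" and \<mu>: "prob_space \<mu>"
    and sets: "sets \<mu> = sets \<pi>" and p: "1 < p"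
  shows "Renyi_le p \<mu> \<pi> R"
proof -
  interpret \<pi>: prob_space \<pi> by fact
  interpret \<mu>: prob_space \<mu> by fact
  define f where "f x = enn2real (RN_deriv \<pi> \<mu> x)" for x
  define J where "J = (\<integral>x. f x powr p \<partial>\<pi>)"
  have [measurable]: "f \<in> borel_measurable \<pi>" unfolding f_def by measurable
  have ac: "absolutely_continuous \<pi> \<mu>" and i: "integrable \<pi> (\<lambda>x. f x powr p)"
    and RJ: "R = p / (p - 1) * ln (J powr (1 / p))"
    using R unfolding Renyi_def f_def J_def by (auto split: if_splits)
  have f0: "0 \<le> f x" for x unfolding f_def by simp
  \<comment> \<open>\<open>enn2real\<close> replaces infinite values by 0; as they occur only on a
    null set, \<open>f\<close> is still a density of \<open>\<mu>\<close>.\<close>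
  have "AE x in \<pi>. RN_deriv \<pi> \<mu> x \<noteq> \<infinity>"
    using \<pi>.RN_deriv_finite[OF \<mu>.sigma_finite_measure_axioms ac sets] .
  then have "density \<pi> (RN_deriv \<pi> \<mu>) = density \<pi> (\<lambda>x. ennreal (f x))"
    unfolding f_def by (intro density_cong) (auto simp: less_top elim!: eventually_mono)
  then have dens: "\<mu> = density \<pi> (\<lambda>x. ennreal (f x))"
    using \<pi>.density_RN_deriv[OF ac sets] by simp
  have nJ: "(\<integral>\<^sup>+x. ennreal (f x powr p) \<partial>\<pi>) = ennreal J"
    unfolding J_def by (rule nn_integral_eq_integral[OF i]) auto
  have J0: "0 \<le> J" unfolding J_def by simp
  have J1: "1 \<le> J"
    by (rule density_powr_bound_ge_one[OF \<pi> \<mu>[unfolded dens] _ f0 _ J0, of p]) (use p nJ in auto)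
  have "exp ((p - 1) * R) = J" using J1 p unfolding RJ by (simp add: ln_powr)
  then show ?thesis unfolding Renyi_le_def using \<mu> dens f0 nJ by (intro conjI bexI[of _ f]) auto
qed

section \<open>The density after one forward and one backward half-step\<close>

context gaussian_kernel
begin

text \<open>Here \<open>\<rho>\<close> is the density of \<open>Y\<close> when \<open>X\<close>
  starts from the current law and \<open>Z\<close> the one when it starts from \<open>\<pi>\<close>,
  so \<open>g\<close> is a likelihood ratio of the laws of \<open>Y\<close>. The moment bound is
  Jensen's inequality under the conditional law of \<open>X\<close> given \<open>Y = y\<close>,
  integrated against \<open>Z\<close>.\<close>

lemma proximal_step_density:
  assumes \<pi>: "prob_space \<pi>" and sets: "sets \<pi> = sets (Rd d)"
    and f [measurable]: "f \<in> borel_measurable (Rd d)" and f0: "\<And>x. 0 \<le> f x"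
    and \<mu>: "prob_space (density \<pi> (\<lambda>x. ennreal (f x)))"
  obtains g where "g \<in> borel_measurable (Rd d)" "\<And>y. 0 \<le> g y"
    "(density \<pi> (\<lambda>x. ennreal (f x)) \<bind> Y_given_X d h) \<bind> X_given_Y d h \<pi> =
       density \<pi> (\<lambda>x. \<integral>\<^sup>+y. ennreal (g y) \<partial>\<gamma> x)"
    "prob_space (density \<pi> (\<lambda>x. \<integral>\<^sup>+y. ennreal (g y) \<partial>\<gamma> x))"
    "(\<lambda>x. \<integral>\<^sup>+y. ennreal (g y) \<partial>\<gamma> x) \<in> borel_measurable \<pi>"
    "\<And>p. 1 \<le> p \<Longrightarrow> (\<integral>\<^sup>+x. \<integral>\<^sup>+y. ennreal (g y powr p) \<partial>\<gamma> x \<partial>\<pi>) \<le> (\<integral>\<^sup>+x. ennreal (f x powr p) \<partial>\<pi>)"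
proof -
  interpret \<pi>: prob_space \<pi> by fact
  interpret pair_sigma_finite \<pi> "Rd d" ..
  have meas: "measurable \<pi> N = measurable (Rd d) N" for N
    by (intro measurable_cong_sets sets refl)
  have meas2: "measurable (\<pi> \<Otimes>\<^sub>M Rd d) N = measurable (Rd d \<Otimes>\<^sub>M Rd d) N" for N
    by (intro measurable_cong_sets sets_pair_measure_cong sets refl)
  have meas3: "measurable (Rd d \<Otimes>\<^sub>M \<pi>) N = measurable (Rd d \<Otimes>\<^sub>M Rd d) N" for N
    by (intro measurable_cong_sets sets_pair_measure_cong sets refl)
  define B where "B = (1 / sqrt (2 * pi * h)) ^ d"
  define \<rho> where "\<rho> y = (\<integral>\<^sup>+x. ennreal (f x) * ennreal (kern x y) \<partial>\<pi>)" for y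
  define Z where "Z y = (\<integral>\<^sup>+z. ennreal (kern y z) \<partial>\<pi>)" for y
  define g where "g y = enn2real (\<rho> y / Z y)" for y
  have km: "(\<lambda>p. ennreal (kern (fst p) (snd p))) \<in> borel_measurable (Rd d \<Otimes>\<^sub>M Rd d)" by measurable
  have Zm [measurable]: "Z \<in> borel_measurable (Rd d)"
    unfolding Z_def by (rule \<pi>.borel_measurable_nn_integral) (use km in \<open>simp add: case_prod_beta' meas3\<close>)
  \<comment> \<open>The kernel is positive and bounded, so \<open>Z\<close> is positive and
    \<open>Z\<close>, \<open>\<rho>\<close> are finite at every point. Hence the divisions are
    genuine and \<open>enn2real\<close> loses nothing.\<close>
  have Z0: "Z y \<noteq> 0" for y
  proof
    assume "Z y = 0"
    then have "AE z in \<pi>. ennreal (kern y z) = 0"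
      unfolding Z_def by (subst (asm) nn_integral_0_iff_AE) (auto simp: meas)
    then have "AE z in \<pi>. False" by eventually_elim (metis ennreal_eq_0_iff kern_pos not_le)
    then show False by simp
  qed
  have Zfin: "Z y < top" for y
  proof -
    have "Z y \<le> (\<integral>\<^sup>+z. ennreal B \<partial>\<pi>)"
      unfolding Z_def B_def by (intro nn_integral_mono ennreal_leI kern_le)
    then show ?thesis using \<pi>.emeasure_space_1 by (auto intro: le_less_trans)
  qed
  have unf: "(\<lambda>x. density (Rd d) (\<lambda>y. ennreal (kern x y))) = Y_given_X d h"
    by (auto simp: Y_given_X_def fun_eq_iff)
  have unf': "(\<lambda>y. density \<pi> (\<lambda>x. ennreal (kern y x) / Z y)) = X_given_Y d h \<pi>"
    by (auto simp: X_given_Y_def fun_eq_iff Z_def)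
  have fY: "density \<pi> (\<lambda>x. ennreal (f x)) \<bind> Y_given_X d h = density (Rd d) \<rho>"
    "prob_space (density (Rd d) \<rho>)" "\<rho> \<in> borel_measurable (Rd d)"
    using bind_density[OF \<pi>.sigma_finite_measure_axioms sigma_finite_Rd[of d] _ \<mu>,
        where k="\<lambda>x y. ennreal (kern x y)"] km
    unfolding unf \<rho>_def by (simp_all add: meas meas2 nn_integral_kern)
  note [measurable] = fY(3)
  have \<rho>fin: "\<rho> y < top" for y
  proof -
    have "\<rho> y \<le> (\<integral>\<^sup>+x. ennreal (f x) * ennreal B \<partial>\<pi>)"
      unfolding \<rho>_def B_def by (intro nn_integral_mono mult_left_mono ennreal_leI kern_le) auto
    also have "\<dots> = (\<integral>\<^sup>+x. ennreal (f x) \<partial>\<pi>) * ennreal B"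
      by (rule nn_integral_multc) (simp add: meas)
    also have "(\<integral>\<^sup>+x. ennreal (f x) \<partial>\<pi>) = 1"
      using prob_space.emeasure_space_1[OF \<mu>] by (simp add: emeasure_density meas cong: nn_integral_cong)
    finally show ?thesis by (auto intro: le_less_trans)
  qed
  have gZ: "ennreal (g y) = \<rho> y / Z y" for y
    unfolding g_def using Z0[of y] \<rho>fin[of y]
    by (intro ennreal_enn2real) (auto simp: less_top[symmetric] ennreal_divide_eq_top_iff)
  have [measurable]: "g \<in> borel_measurable (Rd d)" unfolding g_def by measurable
  have cond1: "(\<integral>\<^sup>+x. ennreal (kern y x) / Z y \<partial>\<pi>) = 1" for y
    using Z0[of y] Zfin[of y] by (subst nn_integral_divide) (auto simp: meas Z_def[symmetric])
  have k2: "(\<lambda>p. ennreal (kern (fst p) (snd p)) / Z (fst p)) \<in> borel_measurable (Rd d \<Otimes>\<^sub>M \<pi>)"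
    unfolding meas3 by measurable
  \<comment> \<open>Symmetry of the kernel turns the backward half-step, relative to
    \<open>\<pi>\<close>, into the Gaussian average of \<open>g = \<rho> / Z\<close>.\<close>
  have Pg: "(\<integral>\<^sup>+y. \<rho> y * (ennreal (kern y x) / Z y) \<partial>Rd d) = (\<integral>\<^sup>+y. ennreal (g y) \<partial>\<gamma> x)" for x
  proof -
    have "(\<integral>\<^sup>+y. ennreal (g y) \<partial>\<gamma> x) = (\<integral>\<^sup>+y. ennreal (kern x y) * ennreal (g y) \<partial>Rd d)"
      by (rule nn_integral_\<gamma>) simp
    also have "\<dots> = (\<integral>\<^sup>+y. \<rho> y * (ennreal (kern y x) / Z y) \<partial>Rd d)"
      unfolding gZ by (intro nn_integral_cong) (simp add: ennreal_times_divide ennreal_divide_times mult.commute kern_commute[of x])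
    finally show ?thesis ..
  qed
  have fX: "density (Rd d) \<rho> \<bind> X_given_Y d h \<pi> = density \<pi> (\<lambda>x. \<integral>\<^sup>+y. ennreal (g y) \<partial>\<gamma> x)"
    "prob_space (density \<pi> (\<lambda>x. \<integral>\<^sup>+y. ennreal (g y) \<partial>\<gamma> x))"
    "(\<lambda>x. \<integral>\<^sup>+y. ennreal (g y) \<partial>\<gamma> x) \<in> borel_measurable \<pi>"
    using bind_density[OF sigma_finite_Rd[of d] \<pi>.sigma_finite_measure_axioms fY(3,2) k2 cond1]
    unfolding unf' Pg by auto
  have "(\<integral>\<^sup>+x. \<integral>\<^sup>+y. ennreal (g y powr p) \<partial>\<gamma> x \<partial>\<pi>) \<le> (\<integral>\<^sup>+x. ennreal (f x powr p) \<partial>\<pi>)" if p: "1 \<le> p" for p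
  proof -
    \<comment> \<open>Multiplying by \<open>Z y\<close> clears the denominator of the conditional
      law, so that integrating over \<open>y\<close> next only meets a kernel of mass one.\<close>
    have jensen: "ennreal (g y powr p) * Z y \<le> (\<integral>\<^sup>+x. ennreal (f x powr p) * ennreal (kern x y) \<partial>\<pi>)" for y
    proof -
      let ?\<nu> = "density \<pi> (\<lambda>x. ennreal (kern y x) / Z y)"
      define J where "J = (\<integral>\<^sup>+x. ennreal (f x powr p) \<partial>?\<nu>)"
      have \<nu>: "prob_space ?\<nu>"
        by (rule prob_spaceI) (simp add: emeasure_density cond1 meas cong: nn_integral_cong)
      have gf: "ennreal (g y) = (\<integral>\<^sup>+x. ennreal (f x) \<partial>?\<nu>)"
      proof -
        have "(\<integral>\<^sup>+x. ennreal (f x) \<partial>?\<nu>) = (\<integral>\<^sup>+x. ennreal (kern y x) / Z y * ennreal (f x) \<partial>\<pi>)"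
          by (rule nn_integral_density) (simp_all add: meas)
        also have "\<dots> = (\<integral>\<^sup>+x. ennreal (f x) * ennreal (kern x y) / Z y \<partial>\<pi>)"
          by (intro nn_integral_cong) (simp add: ennreal_times_divide mult.commute kern_commute[of y])
        also have "\<dots> = \<rho> y / Z y"
          unfolding \<rho>_def by (rule nn_integral_divide) (simp add: meas)
        finally show ?thesis by (simp add: gZ)
      qed
      have "ennreal (g y powr p) \<le> J"
      proof (cases "J = top")
        case False
        then obtain c where c: "0 \<le> c" "J = ennreal c" by (metis ennreal_cases)
        have "(\<integral>\<^sup>+x. ennreal (f x) \<partial>?\<nu>) \<le> ennreal (c powr (1 / p))"
          by (rule prob_space.nn_integral_le_powr[OF \<nu> _ f0 p c(1)]) (use c in \<open>simp_all add: meas J_def[symmetric]\<close>)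
        then have "g y \<le> c powr (1 / p)" unfolding gf[symmetric] by (simp add: ennreal_le_iff)
        then have "g y powr p \<le> (c powr (1 / p)) powr p" using p by (intro powr_mono2) (auto simp: g_def)
        then show ?thesis using c p by (simp add: powr_powr ennreal_leI)
      qed simp
      then have "ennreal (g y powr p) * Z y \<le> J * Z y" by (intro mult_right_mono) auto
      also have "J = (\<integral>\<^sup>+x. ennreal (kern y x) / Z y * ennreal (f x powr p) \<partial>\<pi>)"
        unfolding J_def by (rule nn_integral_density) (simp_all add: meas)
      also have "\<dots> * Z y = (\<integral>\<^sup>+x. ennreal (kern y x) / Z y * ennreal (f x powr p) * Z y \<partial>\<pi>)"
        by (rule nn_integral_multc[symmetric]) (simp add: meas)
      also have "\<dots> = (\<integral>\<^sup>+x. ennreal (f x powr p) * ennreal (kern x y) \<partial>\<pi>)"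
      proof (intro nn_integral_cong)
        fix x
        have "ennreal (kern y x) / Z y * ennreal (f x powr p) * Z y
            = ennreal (f x powr p) * ((ennreal (kern y x) * Z y) / Z y)"
          by (simp add: ennreal_times_divide ennreal_divide_times mult_ac)
        also have "(ennreal (kern y x) * Z y) / Z y = ennreal (kern x y)"
          using Z0[of y] Zfin[of y] by (subst mult_divide_eq_ennreal) (auto simp: kern_commute[of y])
        finally show "ennreal (kern y x) / Z y * ennreal (f x powr p) * Z y = ennreal (f x powr p) * ennreal (kern x y)" .
      qed
      finally show ?thesis .
    qed
    have "(\<integral>\<^sup>+x. \<integral>\<^sup>+y. ennreal (g y powr p) \<partial>\<gamma> x \<partial>\<pi>) = (\<integral>\<^sup>+x. \<integral>\<^sup>+y. ennreal (kern x y) * ennreal (g y powr p) \<partial>Rd d \<partial>\<pi>)"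
      by (subst nn_integral_\<gamma>) auto
    also have "\<dots> = (\<integral>\<^sup>+y. \<integral>\<^sup>+x. ennreal (kern x y) * ennreal (g y powr p) \<partial>\<pi> \<partial>Rd d)"
      by (rule Fubini'[symmetric]) (simp add: case_prod_beta' meas2)
    also have "\<dots> = (\<integral>\<^sup>+y. ennreal (g y powr p) * Z y \<partial>Rd d)"
    proof (intro nn_integral_cong)
      fix y
      have "(\<integral>\<^sup>+x. ennreal (kern x y) * ennreal (g y powr p) \<partial>\<pi>) = (\<integral>\<^sup>+x. ennreal (kern x y) \<partial>\<pi>) * ennreal (g y powr p)"
        by (rule nn_integral_multc) (simp add: meas)
      also have "(\<integral>\<^sup>+x. ennreal (kern x y) \<partial>\<pi>) = Z y"
        unfolding Z_def by (intro nn_integral_cong) (metis kern_commute)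
      finally show "(\<integral>\<^sup>+x. ennreal (kern x y) * ennreal (g y powr p) \<partial>\<pi>) = ennreal (g y powr p) * Z y"
        by (simp only: mult.commute)
    qed
    also have "\<dots> \<le> (\<integral>\<^sup>+y. (\<integral>\<^sup>+x. ennreal (f x powr p) * ennreal (kern x y) \<partial>\<pi>) \<partial>Rd d)"
      by (intro nn_integral_mono jensen)
    also have "\<dots> = (\<integral>\<^sup>+x. (\<integral>\<^sup>+y. ennreal (f x powr p) * ennreal (kern x y) \<partial>Rd d) \<partial>\<pi>)"
      by (rule Fubini') (simp add: case_prod_beta' meas2)
    also have "\<dots> = (\<integral>\<^sup>+x. ennreal (f x powr p) \<partial>\<pi>)"
      by (intro nn_integral_cong) (simp add: nn_integral_cmult nn_integral_kern)
    finally show ?thesis .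
  qed
  then show thesis
    using that[of g] fX unfolding fY(1) by (auto simp: g_def)
qed

text \<open>For the new order \<open>q\<close>, the new norm of order \<open>q\<close> is at most
  the old one of order \<open>p\<close>, but the divergences weight the logarithms of these norms by
  \<open>q / (q - 1)\<close> and \<open>p / (p - 1)\<close>. The ratio of the weights is the factor
  in front of \<open>R\<close>.\<close>

lemma proximal_step_Renyi_le:
  assumes \<pi>: "prob_space \<pi>" "sets \<pi> = sets (Rd d)" "LSI d \<pi> C" "C > 0" and p: "1 < p"
    and \<mu>: "Renyi_le p \<mu> \<pi> R"
  shows "Renyi_le (1 + (p - 1) * (1 + h / C)) ((\<mu> \<bind> Y_given_X d h) \<bind> X_given_Y d h \<pi>) \<pi>
           ((1 + (p - 1) * (1 + h / C)) / (p * (1 + h / C)) * R)"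
proof -
  have meas: "measurable \<pi> N = measurable (Rd d) N" for N
    by (intro measurable_cong_sets \<pi>(2) refl)
  define q where "q = 1 + (p - 1) * (1 + h / C)"
  have q: "q = p + (p - 1) * h / C" unfolding q_def by (simp add: algebra_simps)
  obtain f where prob: "prob_space \<mu>" and f: "f \<in> borel_measurable \<pi>" "\<And>x. 0 \<le> f x"
    and dens: "\<mu> = density \<pi> (\<lambda>x. ennreal (f x))"
    and bound: "(\<integral>\<^sup>+x. ennreal (f x powr p) \<partial>\<pi>) \<le> ennreal (exp ((p - 1) * R))"
    using \<mu> by (rule Renyi_leE) blast
  obtain g where g: "g \<in> borel_measurable (Rd d)" "\<And>y. 0 \<le> g y"
    and \<mu>': "(density \<pi> (\<lambda>x. ennreal (f x)) \<bind> Y_given_X d h) \<bind> X_given_Y d h \<pi> =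
       density \<pi> (\<lambda>x. \<integral>\<^sup>+y. ennreal (g y) \<partial>\<gamma> x)"
    and prob': "prob_space (density \<pi> (\<lambda>x. \<integral>\<^sup>+y. ennreal (g y) \<partial>\<gamma> x))"
    and [measurable]: "(\<lambda>x. \<integral>\<^sup>+y. ennreal (g y) \<partial>\<gamma> x) \<in> borel_measurable \<pi>"
    and gf': "\<And>s. 1 \<le> s \<Longrightarrow> (\<integral>\<^sup>+x. \<integral>\<^sup>+y. ennreal (g y powr s) \<partial>\<gamma> x \<partial>\<pi>) \<le> (\<integral>\<^sup>+x. ennreal (f x powr s) \<partial>\<pi>)"
    by (rule proximal_step_density[OF \<pi>(1,2) f(1)[unfolded meas] f(2) prob[unfolded dens]]) blast
  have gf: "(\<integral>\<^sup>+x. \<integral>\<^sup>+y. ennreal (g y powr p) \<partial>\<gamma> x \<partial>\<pi>) \<le> (\<integral>\<^sup>+x. ennreal (f x powr p) \<partial>\<pi>)"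
    using p by (intro gf') auto
  define f' where "f' x = enn2real (\<integral>\<^sup>+y. ennreal (g y) \<partial>\<gamma> x)" for x
  have f'm [measurable]: "f' \<in> borel_measurable \<pi>" unfolding f'_def by measurable
  \<comment> \<open>Total mass one makes the new density finite almost everywhere, so its
    real-valued version \<open>f'\<close> gives the same measure.\<close>
  have "(\<integral>\<^sup>+x. (\<integral>\<^sup>+y. ennreal (g y) \<partial>\<gamma> x) \<partial>\<pi>) = 1"
    using prob_space.emeasure_space_1[OF prob'] by (simp add: emeasure_density cong: nn_integral_cong)
  then have "AE x in \<pi>. (\<integral>\<^sup>+y. ennreal (g y) \<partial>\<gamma> x) \<noteq> \<infinity>"
    by (intro nn_integral_PInf_AE) auto
  then have "density \<pi> (\<lambda>x. \<integral>\<^sup>+y. ennreal (g y) \<partial>\<gamma> x) = density \<pi> (\<lambda>x. ennreal (f' x))"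
    unfolding f'_def by (intro density_cong) (auto simp: less_top elim!: eventually_mono)
  moreover have "(\<integral>\<^sup>+x. ennreal (f' x powr q) \<partial>\<pi>) \<le> ennreal (exp ((p - 1) * R) powr (q / p))"
    unfolding f'_def q
    by (rule heat_hypercontractive[OF \<pi> g _ _ order_trans[OF gf bound]]) (use p in auto)
  moreover have "exp ((p - 1) * R) powr (q / p) = exp ((q - 1) * (q / (p * (1 + h / C)) * R))"
  proof -
    have "1 + h / C > 0" using h_pos \<pi>(4) by (simp add: add_pos_pos)
    moreover have "q - 1 = (p - 1) * (1 + h / C)" unfolding q_def by simp
    ultimately have "(q - 1) * (q / (p * (1 + h / C)) * R) = (q / p) * ((p - 1) * R)" by simp
    then show ?thesis by (simp add: powr_def)
  qed
  ultimately show ?thesis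
    unfolding Renyi_le_def dens \<mu>' q_def[symmetric] using prob' f'm by (intro conjI bexI[of _ f']) (auto simp: f'_def)
qed

end

section \<open>Iteration\<close>

lemma proximal_law_add:
  "proximal_law d h \<pi> \<mu> (m + n) = proximal_law d h \<pi> (proximal_law d h \<pi> \<mu> m) n"
  by (induction n) auto

lemma proximal_law_Renyi_le:
  assumes "h > 0" "prob_space \<pi>" "sets \<pi> = sets (Rd d)" "LSI d \<pi> C" "C > 0" "1 < p" "Renyi_le p \<mu> \<pi> R"
  shows "Renyi_le (1 + (p - 1) * (1 + h / C) ^ N) (proximal_law d h \<pi> \<mu> N) \<pi> R"
proof (induction N)
  case 0
  then show ?case using assms by simp
next
  case (Suc N)
  interpret gaussian_kernel d h by standard fact
  define \<eta> where "\<eta> = h / C"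
  have \<eta>: "\<eta> > 0" unfolding \<eta>_def using assms by simp
  define q where "q = 1 + (p - 1) * (1 + \<eta>) ^ N"
  have q: "1 < q" unfolding q_def using assms \<eta> by simp
  have R: "0 \<le> R" by (rule Renyi_le_nonneg[OF assms(7,2,6)])
  have "Renyi_le (1 + (q - 1) * (1 + \<eta>)) (proximal_law d h \<pi> \<mu> (Suc N)) \<pi> ((1 + (q - 1) * (1 + \<eta>)) / (q * (1 + \<eta>)) * R)"
    using proximal_step_Renyi_le[OF assms(2-5) q] Suc unfolding \<eta>_def[symmetric] q_def[symmetric] by simp
  moreover have "(1 + (q - 1) * (1 + \<eta>)) / (q * (1 + \<eta>)) * R \<le> 1 * R"
  proof (rule mult_right_mono[OF _ R])
    have "0 < q * (1 + \<eta>)" using q \<eta> by simp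
    moreover have "1 + (q - 1) * (1 + \<eta>) \<le> q * (1 + \<eta>)" using \<eta> by (simp add: algebra_simps)
    ultimately show "(1 + (q - 1) * (1 + \<eta>)) / (q * (1 + \<eta>)) \<le> 1" by (simp only: divide_le_eq_1_pos)
  qed
  moreover have "1 + (q - 1) * (1 + \<eta>) = 1 + (p - 1) * (1 + \<eta>) ^ Suc N" unfolding q_def by simp
  moreover have "1 \<le> 1 + (q - 1) * (1 + \<eta>)" using q \<eta> by simp
  ultimately show ?case unfolding \<eta>_def[symmetric] by (metis Renyi_le_weaken mult_1)
qed

text \<open>A step raises the order from 2 to \<open>2 + h / C\<close>. Returning to order 2 by
  monotonicity gives up the gain in order but keeps the contraction factor, so the step can be
  repeated.\<close>

lemma proximal_law_Renyi_le_two: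
  assumes "h > 0" "prob_space \<pi>" "sets \<pi> = sets (Rd d)" "LSI d \<pi> C" "C > 0" "Renyi_le 2 \<mu> \<pi> R"
  shows "Renyi_le 2 (proximal_law d h \<pi> \<mu> N) \<pi> (((2 + h / C) / (2 * (1 + h / C))) ^ N * R)"
proof (induction N)
  case 0
  then show ?case using assms by simp
next
  case (Suc N)
  interpret gaussian_kernel d h by standard fact
  define \<eta> where "\<eta> = h / C"
  have \<eta>: "\<eta> > 0" unfolding \<eta>_def using assms by simp
  define a where "a = (2 + \<eta>) / (2 * (1 + \<eta>))"
  have "Renyi_le (2 + \<eta>) (proximal_law d h \<pi> \<mu> (Suc N)) \<pi> (a * (a ^ N * R))"
    using proximal_step_Renyi_le[OF assms(2-5) _ Suc] unfolding \<eta>_def[symmetric] a_def by simp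
  then have "Renyi_le 2 (proximal_law d h \<pi> \<mu> (Suc N)) \<pi> (a * (a ^ N * R))"
    by (rule Renyi_le_antimono_exponent) (use \<eta> in auto)
  then show ?case unfolding \<eta>_def[symmetric] a_def[symmetric] by (simp only: power_Suc mult.assoc)
qed

text \<open>\<open>K \<ge> 1\<close> keeps \<open>\<eta>\<close> at most 1/2, where \<open>ln (1 +
  \<eta>) \<ge> \<eta> - \<eta>\<^sup>2 \<ge> \<eta> / 2 = 1 / (4 * K)\<close>.\<close>

lemma le_power_one_plus:
  fixes K x :: real
  assumes K: "1 \<le> K" and x: "0 < x" and N: "4 * K * ln x \<le> real N"
  shows "x \<le> (1 + 1 / (2 * K)) ^ N"
proof -
  define \<eta> where "\<eta> = 1 / (2 * K)"
  have \<eta>: "0 < \<eta>" "\<eta> \<le> 1 / 2" unfolding \<eta>_def using K by (auto simp: field_simps)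
  have "\<eta> / 2 \<le> \<eta> - \<eta>\<^sup>2" using \<eta> mult_left_mono[of \<eta> "1/2" \<eta>] by (simp add: power2_eq_square)
  also have "\<dots> \<le> ln (1 + \<eta>)" using \<eta> by (intro ln_one_plus_pos_lower_bound) auto
  finally have "real N * (\<eta> / 2) \<le> real N * ln (1 + \<eta>)" by (intro mult_left_mono) auto
  moreover have "ln x \<le> real N * (\<eta> / 2)" using N K unfolding \<eta>_def by (simp add: field_simps)
  ultimately have "exp (ln x) \<le> exp (real N * ln (1 + \<eta>))" by simp
  then show ?thesis using x \<eta> unfolding \<eta>_def[symmetric] by (simp add: exp_of_nat_mult)
qed

text \<open>The factor equals \<open>1 - \<eta> / (2 + 2 * \<eta>)\<close>, which for
  \<open>\<eta> \<le> 1/2\<close> is at most \<open>1 - \<eta> / 4\<close>, hence at most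
  \<open>exp (- 1 / (8 * K))\<close>.\<close>

lemma contraction_power_mult_le_one:
  fixes K x :: real
  assumes K: "1 \<le> K" and x: "0 < x" and N: "8 * K * ln x \<le> real N"
  shows "((2 + 1 / (2 * K)) / (2 * (1 + 1 / (2 * K)))) ^ N * x \<le> 1"
proof -
  define \<eta> where "\<eta> = 1 / (2 * K)"
  have \<eta>: "0 < \<eta>" "\<eta> \<le> 1 / 2" unfolding \<eta>_def using K by (auto simp: field_simps)
  have "(2 + \<eta>) / (2 * (1 + \<eta>)) \<le> 1 - \<eta> / 4"
    using \<eta> mult_left_mono[of \<eta> "1/2" \<eta>] by (simp add: field_simps)
  also have "\<dots> \<le> exp (- (\<eta> / 4))" using exp_ge_add_one_self[of "- (\<eta> / 4)"] by simp
  finally have "((2 + \<eta>) / (2 * (1 + \<eta>))) ^ N \<le> exp (- (\<eta> / 4)) ^ N" using \<eta> by (intro power_mono) auto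
  also have "\<dots> = exp (- (real N * (\<eta> / 4)))" by (simp flip: exp_of_nat_mult)
  also have "\<dots> \<le> exp (- ln x)" using N K unfolding \<eta>_def by (simp add: field_simps)
  also have "\<dots> = 1 / x" using x by (simp add: exp_minus field_simps)
  finally show ?thesis unfolding \<eta>_def[symmetric] using x by (simp add: field_simps)
qed

lemma LSI_mono:
  assumes "LSI d \<pi> C" "C \<le> C'"
  shows "LSI d \<pi> C'"
  unfolding LSI_def
proof (intro conjI allI impI)
  show "0 \<le> C'" using assms unfolding LSI_def by simp
  fix f assume f: "locally_Lipschitz d f" "integrable \<pi> (\<lambda>x. (f x)\<^sup>2)" "integrable \<pi> (grad_sq d f)"
  then show "integrable \<pi> (\<lambda>x. (f x)\<^sup>2 * ln ((f x)\<^sup>2))" using assms(1) unfolding LSI_def by blast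
  have "(\<integral>x. (f x)\<^sup>2 * ln ((f x)\<^sup>2) \<partial>\<pi>) - (\<integral>x. (f x)\<^sup>2 \<partial>\<pi>) * ln (\<integral>x. (f x)\<^sup>2 \<partial>\<pi>)
      \<le> 2 * C * (\<integral>x. grad_sq d f x \<partial>\<pi>)"
    using assms(1) f unfolding LSI_def by blast
  moreover have "0 \<le> (\<integral>x. grad_sq d f x \<partial>\<pi>)"
    by (intro Bochner_Integration.integral_nonneg) (simp add: grad_sq_def sum_nonneg)
  then have "2 * C * (\<integral>x. grad_sq d f x \<partial>\<pi>) \<le> 2 * C' * (\<integral>x. grad_sq d f x \<partial>\<pi>)"
    using assms(2) by (intro mult_right_mono) auto
  ultimately show "(\<integral>x. (f x)\<^sup>2 * ln ((f x)\<^sup>2) \<partial>\<pi>) - (\<integral>x. (f x)\<^sup>2 \<partial>\<pi>) * ln (\<integral>x. (f x)\<^sup>2 \<partial>\<pi>)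
      \<le> 2 * C' * (\<integral>x. grad_sq d f x \<partial>\<pi>)"
    by linarith
qed

lemma LSI_above_C_LSI:
  assumes "\<exists>C. LSI d \<pi> C" "C_LSI d \<pi> < C'"
  shows "LSI d \<pi> C'"
proof -
  have "{C. LSI d \<pi> C} \<noteq> {}" using assms(1) by auto
  then obtain C where "LSI d \<pi> C" "C < C'"
    using cInf_lessD[of "{C. LSI d \<pi> C}" C'] assms(2) unfolding C_LSI_def by auto
  then show ?thesis using LSI_mono by (meson less_imp_le)
qed

text \<open>The maximum with 1 makes \<open>h / C\<close> at most 1/2 for the chosen
  \<open>C\<close> and leaves room for rounding to whole steps; \<open>max R \<epsilon>\<close>
  keeps the logarithm meaningful when \<open>R\<close> is below \<open>\<epsilon>\<close> or zero.
  The constant 12 is the 8 of the contraction phase plus 4 that absorb the rounding; raising the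
  order costs only 4.\<close>

theorem corollary1p3:
  "\<exists>c::real. c > 0 \<and>
     (\<forall>(d::nat) (h::real) (\<pi>::(nat \<Rightarrow> real) measure) (\<pi>0::(nat \<Rightarrow> real) measure).
        d \<ge> 1 \<longrightarrow> h > 0 \<longrightarrow>
        prob_space \<pi> \<longrightarrow> sets \<pi> = sets (Rd d) \<longrightarrow> absolutely_continuous (Rd d) \<pi> \<longrightarrow>
        (\<exists>C. LSI d \<pi> C) \<longrightarrow>
        prob_space \<pi>0 \<longrightarrow> sets \<pi>0 = sets (Rd d) \<longrightarrow>
        (\<forall>(p::real) (q::real) (N::nat).
           1 < p \<longrightarrow> p \<le> q \<longrightarrow>
           real N \<ge> c * max 1 (inverse h * C_LSI d \<pi>) * log 2 ((q - 1) / (p - 1)) \<longrightarrow>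
           Renyi q (proximal_law d h \<pi> \<pi>0 N) \<pi> \<le> Renyi p \<pi>0 \<pi>)
        \<and>
        (\<forall>(\<epsilon>::real) (q::real) (q0::real) (R::real) (N::nat).
           \<epsilon> > 0 \<longrightarrow> 1 < q0 \<longrightarrow> q0 \<le> q \<longrightarrow>
           Renyi (min 2 q0) \<pi>0 \<pi> = ereal R \<longrightarrow>
           real N \<ge> c * max 1 (inverse h * C_LSI d \<pi>)
                       * ln (q * max R \<epsilon> / ((min 2 q0 - 1) * \<epsilon>)) \<longrightarrow>
           Renyi q (proximal_law d h \<pi> \<pi>0 N) \<pi> \<le> ereal \<epsilon>))"
proof (intro exI[of _ "12::real"] conjI allI impI)
  fix d :: nat and h :: real and \<pi> \<pi>0 :: "(nat \<Rightarrow> real) measure"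
  assume h: "h > 0" and \<pi>: "prob_space \<pi>" "sets \<pi> = sets (Rd d)" and lsi: "\<exists>C. LSI d \<pi> C"
    and \<pi>0: "prob_space \<pi>0" "sets \<pi>0 = sets (Rd d)"
  define K where "K = max 1 (inverse h * C_LSI d \<pi>)"
  \<comment> \<open>Strictly above \<open>C_LSI\<close>, so that no attainment of the infimum is needed, also if \<open>C_LSI\<close> vanishes.\<close>
  define C where "C = 2 * K * h"
  have K: "1 \<le> K" unfolding K_def by simp
  have C: "C > 0" unfolding C_def using K h by simp
  have \<eta>: "h / C = 1 / (2 * K)" unfolding C_def using K h by simp
  have "C_LSI d \<pi> \<le> K * h" unfolding K_def using h by (simp add: max_def field_simps)
  also have "\<dots> < C" unfolding C_def using K h by simp
  finally have LSI: "LSI d \<pi> C" by (rule LSI_above_C_LSI[OF lsi])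
  have sets0: "sets \<pi>0 = sets \<pi>" using \<pi>0 \<pi> by simp
  note hyper = proximal_law_Renyi_le[OF h \<pi> LSI C, unfolded \<eta>]
  note decay = proximal_law_Renyi_le_two[OF h \<pi> LSI C, unfolded \<eta>]
  {
    fix p q :: real and N :: nat
    assume pq: "1 < p" "p \<le> q"
      and N: "real N \<ge> 12 * max 1 (inverse h * C_LSI d \<pi>) * log 2 ((q - 1) / (p - 1))"
    show "Renyi q (proximal_law d h \<pi> \<pi>0 N) \<pi> \<le> Renyi p \<pi>0 \<pi>"
    proof (cases "Renyi p \<pi>0 \<pi> = \<infinity>")
      case False
      then obtain R where R: "Renyi p \<pi>0 \<pi> = ereal R" unfolding Renyi_def by (auto split: if_splits)
      define x where "x = (q - 1) / (p - 1)"
      have x: "1 \<le> x" unfolding x_def using pq by simp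
      have "ln x * 1 \<le> ln x * (1 / ln 2)" using x ln_2_less_1 by (intro mult_left_mono) auto
      then have "ln x \<le> log 2 x" unfolding log_def by simp
      then have "4 * K * ln x \<le> 12 * K * log 2 x" using x K by (intro mult_mono) auto
      also have "\<dots> \<le> real N" using N unfolding K_def x_def .
      finally have "x \<le> (1 + 1 / (2 * K)) ^ N" using K x by (intro le_power_one_plus) auto
      \<comment> \<open>The order reached after \<open>N\<close> steps may overshoot
        \<open>q\<close>; monotonicity in the order brings it back.\<close>
      then have "q \<le> 1 + (p - 1) * (1 + 1 / (2 * K)) ^ N" unfolding x_def using pq by (simp add: field_simps)
      moreover have "Renyi_le (1 + (p - 1) * (1 + 1 / (2 * K)) ^ N) (proximal_law d h \<pi> \<pi>0 N) \<pi> R"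
        using pq by (intro hyper Renyi_eq_imp_Renyi_le[OF R \<pi>(1) \<pi>0(1) sets0]) auto
      ultimately have "Renyi_le q (proximal_law d h \<pi> \<pi>0 N) \<pi> R"
        using pq by (intro Renyi_le_antimono_exponent[where p'=q]) auto
      then show ?thesis unfolding R using pq by (intro Renyi_le_imp_Renyi \<pi>) auto
    qed simp
  next
    fix \<epsilon> q q0 R :: real and N :: nat
    assume \<epsilon>: "\<epsilon> > 0" and q: "1 < q0" "q0 \<le> q" and R: "Renyi (min 2 q0) \<pi>0 \<pi> = ereal R"
      and N: "real N \<ge> 12 * max 1 (inverse h * C_LSI d \<pi>) * ln (q * max R \<epsilon> / ((min 2 q0 - 1) * \<epsilon>))"
    define p0 where "p0 = min 2 q0"
    define S where "S = max R \<epsilon>"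
    have p0: "1 < p0" "p0 \<le> 2" "p0 \<le> q" unfolding p0_def using q by auto
    have S: "S > 0" "S \<ge> \<epsilon>" unfolding S_def using \<epsilon> by auto
    define A B D where "A = ln (1 / (p0 - 1))" and "B = ln (S / \<epsilon>)" and "D = ln q"
    have ABD: "0 \<le> A" "0 \<le> B" "0 \<le> D"
      unfolding A_def B_def D_def using p0 S \<epsilon> by auto
    have "ln (q * S / ((p0 - 1) * \<epsilon>)) = A + B + D"
      unfolding A_def B_def D_def using p0 S \<epsilon> by (simp add: ln_mult ln_div)
    then have N': "12 * K * (A + B + D) \<le> real N" using N unfolding K_def p0_def S_def by simp
    \<comment> \<open>Bounds the logarithm away from 0, so that a multiple of it can pay for the two
      ceilings. If \<open>q0 \<le> 2\<close>, then \<open>2 * (q0 - 1) \<le> q0 \<le> q\<close>;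
      otherwise the denominator is 1 and \<open>q > 2\<close>.\<close>
    have "ln 2 \<le> A + D"
    proof -
      have "2 \<le> q / (p0 - 1)"
      proof (cases "q0 \<le> 2")
        case True
        then have "2 * (p0 - 1) \<le> q" unfolding p0_def using q by simp
        then show ?thesis using p0 by (simp add: le_divide_eq)
      next
        case False
        then show ?thesis unfolding p0_def using q by simp
      qed
      then have "ln 2 \<le> ln (q / (p0 - 1))" by (intro ln_mono) auto
      also have "\<dots> = A + D" unfolding A_def D_def using p0 by (simp add: ln_div)
      finally show ?thesis .
    qed
    moreover have "1 / 2 \<le> ln (2::real)" using ln2_ge_two_thirds by simp
    ultimately have "1 / 2 \<le> A + B + D" using ABD by simp
    then have "1 * (1 / 2) \<le> K * (A + B + D)" using K by (intro mult_mono) auto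
    then have absorb: "2 \<le> 4 * K * (A + B + D)" by simp
    \<comment> \<open>\<open>N1\<close> steps raise the order from \<open>p0\<close> to 2, \<open>N2\<close> contract the divergence of order 2, \<open>N3\<close> raise the order to \<open>q\<close>.\<close>
    define N1 N3 where "N1 = nat \<lceil>4 * K * A\<rceil>" and "N3 = nat \<lceil>4 * K * D\<rceil>"
    have "0 \<le> 4 * K * A" "0 \<le> 4 * K * D" using K ABD by auto
    then have N1: "4 * K * A \<le> real N1" "real N1 \<le> 4 * K * A + 1"
      and N3: "4 * K * D \<le> real N3" "real N3 \<le> 4 * K * D + 1"
      unfolding N1_def N3_def by linarith+
    have KABD: "0 \<le> K * A" "0 \<le> K * B" "0 \<le> K * D" using K ABD by auto
    have N2: "real N1 + real N3 + 8 * K * B \<le> real N"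
      using N1 N3 N' absorb KABD by (simp add: algebra_simps)
    then have "real (N1 + N3) \<le> real N" using KABD by simp
    then have le: "N1 + N3 \<le> N" by linarith
    \<comment> \<open>All surplus steps go to the contraction phase, so the three phases add up to
      exactly \<open>N\<close>.\<close>
    define N2 where "N2 = N - N1 - N3"
    have N2': "8 * K * B \<le> real N2" unfolding N2_def using N2 le by (simp add: of_nat_diff)
    have Neq: "N = (N1 + N2) + N3" unfolding N2_def using le by simp
    define \<mu>1 where "\<mu>1 = proximal_law d h \<pi> \<pi>0 N1"
    define \<mu>2 where "\<mu>2 = proximal_law d h \<pi> \<mu>1 N2"
    have "Renyi_le p0 \<pi>0 \<pi> R" using R p0 by (intro Renyi_eq_imp_Renyi_le \<pi> \<pi>0 sets0) (auto simp: p0_def)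
    then have "Renyi_le p0 \<pi>0 \<pi> S" by (rule Renyi_le_weaken) (use p0 in \<open>auto simp: S_def\<close>)
    then have \<mu>1: "Renyi_le (1 + (p0 - 1) * (1 + 1 / (2 * K)) ^ N1) \<mu>1 \<pi> S"
      unfolding \<mu>1_def using p0 by (intro hyper) auto
    have "1 / (p0 - 1) \<le> (1 + 1 / (2 * K)) ^ N1"
      using K p0 N1 unfolding A_def by (intro le_power_one_plus) auto
    then have "1 \<le> (1 + 1 / (2 * K)) ^ N1 * (p0 - 1)" using p0 by (subst (asm) pos_divide_le_eq) auto
    then have "2 \<le> 1 + (p0 - 1) * (1 + 1 / (2 * K)) ^ N1" by (simp add: mult.commute)
    then have "Renyi_le 2 \<mu>1 \<pi> S" using Renyi_le_antimono_exponent[OF \<mu>1, of 2] by simp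
    then have "Renyi_le 2 \<mu>2 \<pi> (((2 + 1 / (2 * K)) / (2 * (1 + 1 / (2 * K)))) ^ N2 * S)"
      unfolding \<mu>2_def by (rule decay)
    moreover have "((2 + 1 / (2 * K)) / (2 * (1 + 1 / (2 * K)))) ^ N2 * (S / \<epsilon>) \<le> 1"
      using K S \<epsilon> N2' unfolding B_def by (intro contraction_power_mult_le_one) auto
    then have "((2 + 1 / (2 * K)) / (2 * (1 + 1 / (2 * K)))) ^ N2 * S \<le> \<epsilon>" using \<epsilon> by (simp add: divide_le_eq)
    ultimately have "Renyi_le 2 \<mu>2 \<pi> \<epsilon>" by (rule Renyi_le_weaken) simp
    then have \<mu>3: "Renyi_le (1 + (2 - 1) * (1 + 1 / (2 * K)) ^ N3) (proximal_law d h \<pi> \<mu>2 N3) \<pi> \<epsilon>"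
      by (intro hyper) auto
    have "q \<le> (1 + 1 / (2 * K)) ^ N3" using K p0 N3 unfolding D_def by (intro le_power_one_plus) auto
    then have "Renyi_le q (proximal_law d h \<pi> \<mu>2 N3) \<pi> \<epsilon>"
      using p0 by (intro Renyi_le_antimono_exponent[OF \<mu>3]) auto
    then show "Renyi q (proximal_law d h \<pi> \<pi>0 N) \<pi> \<le> ereal \<epsilon>"
      unfolding Neq proximal_law_add \<mu>2_def \<mu>1_def using p0 by (intro Renyi_le_imp_Renyi \<pi>) auto
  }
qed simp

end
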